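(* Let $\lambda$ be a singular cardinal (i.e. $\lambda > \mathrm{cf}(\lambda)$), let $\mu = 2^\lambda$, and let $\kappa = \min\{\kappa : 2^\kappa > \mu\}$. Then there is a Hausdorff topological space $X$ with a basis consisting of clopen sets such that $|X| = 2^\kappa$ and, for every closed $Y \subseteq X$, if $|Y| < |X|$ then $|Y| < \lambda$. *)

theory Defs
  imports "HOL-Analysis.Analysis"
begin

unbundle cardinal_syntax

text \<open>
  Cardinals are well-orders satisfying \<^term>\<open>Card_order\<close>, compared by \<open>\<le>o\<close>, \<open>=o\<close>, \<open><o\<close>.
  As \<open>\<le>o\<close> is not antisymmetric, the minimum of a set of cardinals is determined only up to \<open>=o\<close>.
\<close>

definition is_min_card :: "'a rel set \<Rightarrow> 'a rel \<Rightarrow> bool"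
  where "is_min_card R r \<longleftrightarrow> r \<in> R \<and> (\<forall>r'\<in>R. r \<le>o r')"

text \<open>
  The library's \<^const>\<open>cofinal\<close> asks for strict upper bounds, which on infinite cardinals
  is the same as the usual non-strict notion.
\<close>

definition cofinality :: "'a rel \<Rightarrow> 'a rel"
  where "cofinality r = (SOME c. is_min_card {|K| | K. K \<subseteq> Field r \<and> cofinal K r} c)"

definition singular_card :: "'a rel \<Rightarrow> bool"
  where "singular_card r \<longleftrightarrow> Cinfinite r \<and> cofinality r <o r"

definition has_clopen_basis :: "'a topology \<Rightarrow> bool"
  where "has_clopen_basis X \<longleftrightarrow>
    (\<exists>B. (\<forall>U\<in>B. openin X U \<and> closedin X U) \<and> openin X = arbitrary union_of (\<lambda>U. U \<in> B))"

lemma is_min_card_exists: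
  assumes "R \<noteq> {}" "\<And>r. r \<in> R \<Longrightarrow> Card_order r"
  shows "\<exists>r. is_min_card R r"
  using exists_minim_Card_order[of R] assms unfolding is_min_card_def by blast

lemma is_min_card_cofinality:
  assumes "Cinfinite r"
  shows "is_min_card {|K| | K. K \<subseteq> Field r \<and> cofinal K r} (cofinality r)"
proof -
  have "cofinal (Field r) r"
    unfolding cofinal_def
    using assms infinite_Card_order_limit[of r] by (auto simp: cinfinite_def)
  then have "\<exists>c. is_min_card {|K| | K. K \<subseteq> Field r \<and> cofinal K r} c"
    by (intro is_min_card_exists) (auto simp: card_of_Card_order)
  then show ?thesis
    unfolding cofinality_def by (rule someI_ex)
qed

text \<open>
  A minimum over the cardinals carried by one type is a minimum over the cardinals of all types,
  and the type carrying \<open>m\<close> already contains a cardinal \<open>k\<close> with \<open>m <o 2\<^sup>k\<close>.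
\<close>

lemma least_exponent_exists:
  fixes m :: "'m rel"
  assumes "Card_order m"
  shows "\<exists>k :: 'm rel. is_min_card {k. Card_order k \<and> m <o ctwo ^c k} k"
proof (rule is_min_card_exists)
  have "m <o ctwo ^c m"
    by (rule ordLess_ctwo_cexp[OF assms])
  then show "{k :: 'm rel. Card_order k \<and> m <o ctwo ^c k} \<noteq> {}"
    using assms by blast
qed simp

lemma least_exponent_global:
  fixes k :: "'k rel" and l :: "'l rel"
  assumes k: "is_min_card {k. Card_order k \<and> m <o ctwo ^c k} k"
    and l: "Card_order l" "m <o ctwo ^c l"
  shows "k \<le>o l"
proof (rule ccontr)
  assume "\<not> k \<le>o l"
  moreover have kc: "Card_order k"
    using k by (simp add: is_min_card_def)
  ultimately have lk: "l <o k"
    using l(1) ordLess_or_ordLeq[of l k] by (auto simp: card_order_on_well_order_on)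
  then have "|Field l| \<le>o |Field k|"
    by (metis card_of_mono2 ordLess_imp_ordLeq)
  then obtain f where f: "inj_on f (Field l)" "f ` Field l \<subseteq> Field k"
    using card_of_ordLeq by metis
  have "|f ` Field l| =o |Field l|"
    using f(1) by (metis card_of_ordIso bij_betw_imageI ordIso_symmetric)
  also have "|Field l| =o l"
    using l(1) by (rule card_of_Field_ordIso)
  finally have iso: "|f ` Field l| =o l" .
  then have "ctwo ^c |f ` Field l| =o ctwo ^c l"
    using l(1) by (intro cexp_cong2 Card_order_ctwo card_of_Card_order)
  then have "m <o ctwo ^c |f ` Field l|"
    using l(2) ordIso_symmetric ordLess_ordIso_trans by blast
  then have "k \<le>o |f ` Field l|"
    using k by (auto simp: is_min_card_def card_of_Card_order)
  then have "k \<le>o l"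
    using iso ordLeq_ordIso_trans by blast
  then show False
    using \<open>\<not> k \<le>o l\<close> by blast
qed

end

theory Submission
  imports Defs
begin

text \<open>
  The points are the subsets of \<open>\<kappa>\<close>. As \<open>\<lambda> \<le> \<kappa> \<le> 2\<^sup>\<lambda>\<close>, they are enumerated along a
  well-founded relation, most of them together with an injection \<open>e\<^sub>x\<close> of \<open>\<lambda>\<close> into the points
  below \<open>x\<close>, such that every injection occurs \<open>2\<^sup>\<kappa>\<close> times;
  and \<open>x\<close> becomes a limit of \<open>e\<^sub>x\<close> along an ultrafilter \<open>D\<^sub>x\<close> containing the range of \<open>e\<^sub>x\<close>. A set \<open>U\<close>
  is clopen when \<open>x \<in> U\<close> is equivalent to \<open>U \<in> D\<^sub>x\<close> for all such \<open>x\<close>. A closed set with at least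
  \<open>\<lambda>\<close> points then contains the \<open>2\<^sup>\<kappa>\<close> limits of one of its subsets.

  Such clopen sets separate points as soon as any at most \<open>\<lambda>\<close> of the ultrafilters have pairwise
  disjoint members \<open>E\<^sub>x\<close>: a set of size \<open>\<lambda>\<close> closed under passing from \<open>x\<close> to the range of \<open>e\<^sub>x\<close>
  then becomes a forest, and the set of descendants of a point extends to a clopen set.
  To obtain disjoint members, cut \<open>\<lambda>\<close> into blocks \<open>[\<pi>, \<pi>\<^sup>+)\<close>. If \<open>e\<^sub>x(\<alpha>) = e\<^sub>y(\<beta>)\<close> with \<open>\<beta> < \<alpha>\<close>, then
  \<open>\<alpha> \<mapsto> \<beta>\<close> is regressive and injective, so by pressing down only a negligible set of \<open>\<alpha>\<close> is
  concerned, even for \<open>\<pi>\<close> many pairs \<open>(x, y)\<close> at once. The collisions with \<open>\<alpha> = \<beta>\<close> are avoided by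
  an Ulam colouring of the blocks, combined with independent functions that assign different
  colours to different points.
\<close>

section \<open>Cardinal and order preliminaries\<close>

lemma underS_trans:
  assumes "Well_order r" "b \<in> underS r a" "c \<in> underS r b"
  shows "c \<in> underS r a"
proof -
  have "trans r" "antisym r"
    using assms(1) by (simp_all add: well_order_on_def linear_order_on_def partial_order_on_def preorder_on_def)
  moreover have "(b, a) \<in> r" "(c, b) \<in> r" "b \<noteq> a"
    using assms(2,3) by (simp_all add: underS_def)
  ultimately show ?thesis
    unfolding underS_def by (blast dest: transD antisymD)
qed

lemma underS_total:
  assumes "Well_order r" "a \<in> Field r" "b \<in> Field r"
  shows "a = b \<or> a \<in> underS r b \<or> b \<in> underS r a"
  using assms
  by (auto simp: well_order_on_def linear_order_on_def total_on_def underS_def)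

lemma underS_minimal:
  assumes "Well_order r" "W \<subseteq> Field r" "W \<noteq> {}"
  obtains a where "a \<in> W" "underS r a \<inter> W = {}"
proof -
  have "wf (r - Id)" using assms(1) by (simp add: well_order_on_def)
  moreover obtain w where "w \<in> W" using assms(3) by blast
  ultimately obtain a where a: "a \<in> W" "\<And>b. (b, a) \<in> r - Id \<Longrightarrow> b \<notin> W"
    by (rule wfE_min) blast
  have "underS r a \<inter> W = {}" using a(2) by (auto simp: underS_def)
  with a(1) show thesis by (rule that)
qed

lemma underS_subset_Field: "underS r a \<subseteq> Field r"
  by (auto simp: underS_def Field_def)

lemma card_of_ordLeq_self: "|A| \<le>o |A|"
  by (rule card_of_mono1) (rule subset_refl)

lemma subset_ordLeq:
  assumes "A \<subseteq> B" "|B| \<le>o r"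
  shows "|A| \<le>o r"
  using card_of_mono1[OF assms(1)] assms(2) by (rule ordLeq_transitive)

lemma finite_ordLeq_infinite:
  assumes "finite A" "infinite B"
  shows "|A| \<le>o |B|"
proof (rule ccontr)
  assume "\<not> |A| \<le>o |B|"
  then have "|B| \<le>o |A|"
    using ordLeq_total[OF card_of_Well_order card_of_Well_order, of A B] by blast
  then show False using assms card_of_ordLeq_finite by blast
qed

lemma Un_ordLeq_infinite:
  assumes "infinite C" "|A| \<le>o |C|" "|B| \<le>o |C|"
  shows "|A \<union> B| \<le>o |C|"
  using card_of_Un_ordLeq_infinite_Field[OF _ assms(2,3) card_of_Card_order] assms(1)
  by (simp add: Field_card_of)

section \<open>Small subsets of a successor cardinal\<close>

text \<open>
  When \<open>r\<close> is the successor cardinal of \<open>|P|\<close>, this ideal takes the part of the nonstationary ideal.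
\<close>

definition small :: "'a rel \<Rightarrow> 'b set \<Rightarrow> 'a set \<Rightarrow> bool"
  where "small r P N \<longleftrightarrow>
    (\<exists>f. (\<forall>a\<in>N. f a \<in> underS r a) \<and> (\<forall>b. |{a \<in> N. f a = b}| \<le>o |P| ))"

lemma small_subset:
  assumes "small r P N" "M \<subseteq> N"
  shows "small r P M"
proof -
  obtain f where f: "\<forall>a\<in>N. f a \<in> underS r a" "\<And>b. |{a \<in> N. f a = b}| \<le>o |P|"
    using assms(1) unfolding small_def by blast
  have "|{a \<in> M. f a = b}| \<le>o |P|" for b
    using assms(2) by (intro subset_ordLeq[OF _ f(2)[of b]]) auto
  then show ?thesis using f(1) assms(2) unfolding small_def by blast
qed

text \<open>Completeness of the ideal: the regressive functions are glued by selecting one index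
  \<open>i a\<close> for each \<open>a\<close>. A fibre of the result lies in a union of at most
  \<open>|P|\<close> of the given fibres.\<close>

lemma small_UN:
  assumes "infinite P" "|I| \<le>o |P|" "\<And>i. i \<in> I \<Longrightarrow> small r P (N i)"
  shows "small r P (\<Union>i\<in>I. N i)"
proof -
  have "\<forall>i\<in>I. \<exists>f. (\<forall>a\<in>N i. f a \<in> underS r a) \<and> (\<forall>b. |{a \<in> N i. f a = b}| \<le>o |P| )"
    using assms(3) unfolding small_def by blast
  from bchoice[OF this] obtain f where
    f: "\<And>i a. i \<in> I \<Longrightarrow> a \<in> N i \<Longrightarrow> f i a \<in> underS r a"
      "\<And>i b. i \<in> I \<Longrightarrow> |{a \<in> N i. f i a = b}| \<le>o |P|"
    by blast
  define i where "i a = (SOME i. i \<in> I \<and> a \<in> N i)" for a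
  have i: "i a \<in> I \<and> a \<in> N (i a)" if "a \<in> (\<Union>i\<in>I. N i)" for a
  proof -
    have "\<exists>i. i \<in> I \<and> a \<in> N i" using that by blast
    from someI_ex[OF this] show ?thesis by (simp add: i_def)
  qed
  show ?thesis unfolding small_def
  proof (intro exI[of _ "\<lambda>a. f (i a) a"] conjI ballI allI)
    fix b
    have "{a \<in> \<Union>i\<in>I. N i. f (i a) a = b} \<subseteq> (\<Union>j\<in>I. {a \<in> N j. f j a = b})"
    proof
      fix a assume "a \<in> {a \<in> \<Union>i\<in>I. N i. f (i a) a = b}"
      then show "a \<in> (\<Union>j\<in>I. {a \<in> N j. f j a = b})"
        using i[of a] by auto
    qed
    moreover have "|\<Union>j\<in>I. {a \<in> N j. f j a = b}| \<le>o |P|"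
      using assms(1,2) f(2) by (intro card_of_UNION_ordLeq_infinite) auto
    ultimately show "|{a \<in> \<Union>i\<in>I. N i. f (i a) a = b}| \<le>o |P|"
      by (rule subset_ordLeq)
  next
    fix a assume "a \<in> (\<Union>i\<in>I. N i)"
    from i[OF this] show "f (i a) a \<in> underS r a" by (intro f(1)) auto
  qed
qed

lemma small_Un:
  assumes "infinite P" "small r P M" "small r P N"
  shows "small r P (M \<union> N)"
proof -
  have "|{True, False}| \<le>o |P|"
    using assms(1) by (intro finite_ordLeq_infinite) auto
  then have "small r P (\<Union>i\<in>{True, False}. if i then M else N)"
    using assms by (intro small_UN) auto
  then show ?thesis by (simp add: Un_commute)
qed

text \<open>Fibres of an injective function have at most one point. In this form pressing down is
  applied to collisions.\<close>

lemma small_inj: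
  assumes "infinite P" "inj_on f N" "\<And>a. a \<in> N \<Longrightarrow> f a \<in> underS r a"
  shows "small r P N"
  unfolding small_def
proof (intro exI[of _ f] conjI ballI allI)
  fix b
  have "finite {a \<in> N. f a = b}"
    by (rule inj_on_finite[of f _ "{b}"]) (use assms(2) in \<open>auto simp: inj_on_def\<close>)
  then show "|{a \<in> N. f a = b}| \<le>o |P|"
    using assms(1) by (rule finite_ordLeq_infinite)
qed (use assms in auto)

lemma small_if_bounded:
  assumes "|N| \<le>o |P|" "\<And>a. a \<in> N \<Longrightarrow> z \<in> underS r a"
  shows "small r P N"
  unfolding small_def using assms
  by (intro exI[of _ "\<lambda>_. z"] conjI ballI allI subset_ordLeq[OF _ assms(1)]) auto

text \<open>This makes the ideal proper. Iterating a regressive function from a point of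
  \<open>S\<close> leaves \<open>B\<close> after finitely many steps, so the iterated preimages of
  \<open>S - B\<close> exhaust \<open>S\<close>; countably many sets of size at most
  \<open>|P|\<close> cannot do that.\<close>

lemma not_small_if_co_small:
  assumes r: "Well_order r" and P: "infinite P"
    and S: "underS r m = S" "\<not> |S| \<le>o |P|" and B: "B \<subseteq> S" "|S - B| \<le>o |P|"
  shows "\<not> small r P B"
proof
  assume "small r P B"
  then obtain f where f: "\<And>a. a \<in> B \<Longrightarrow> f a \<in> underS r a" "\<And>b. |{a \<in> B. f a = b}| \<le>o |P|"
    unfolding small_def by blast
  \<comment> \<open>\<open>W n\<close> holds the points carried into \<open>S - B\<close> by exactly
    \<open>n\<close> applications of \<open>f\<close>.\<close>
  define W where "W = rec_nat (S - B) (\<lambda>_ V. \<Union>b\<in>V. {a \<in> B. f a = b})"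
  have W: "|W n| \<le>o |P|" "W n \<subseteq> S" for n
    by (induction n) (use B f(2) P in \<open>auto simp: W_def intro!: card_of_UNION_ordLeq_infinite\<close>)
  have "|\<Union>n. W n| \<le>o |P|"
    using P W(1) infinite_iff_card_of_nat by (intro card_of_UNION_ordLeq_infinite) auto
  then have "\<not> S \<subseteq> (\<Union>n. W n)"
    using S(2) subset_ordLeq by blast
  then have ne: "S - (\<Union>n. W n) \<noteq> {}" by blast
  have "S - (\<Union>n. W n) \<subseteq> Field r"
    using S(1) underS_subset_Field[of r m] by blast
  then obtain a where a: "a \<in> S - (\<Union>n. W n)" "underS r a \<inter> (S - (\<Union>n. W n)) = {}"
    using ne by (rule underS_minimal[OF r])
  have "W 0 = S - B" by (simp add: W_def)
  then have "a \<in> B" using a(1) by blast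
  then have "f a \<in> underS r a" by (rule f(1))
  moreover have "underS r a \<subseteq> S"
    using a(1) S(1) underS_trans[OF r, of a m] by blast
  ultimately obtain n where "f a \<in> W n" using a(2) by blast
  then have "a \<in> W (Suc n)" using \<open>a \<in> B\<close> by (simp add: W_def)
  then show False using a(1) by blast
qed

text \<open>An Ulam matrix: for \<open>b\<close> below \<open>a\<close>, the index \<open>g a b\<close> depends injectively on \<open>b\<close>.\<close>

lemma colouring_with_nonsmall_classes:
  assumes r: "Well_order r" and P: "infinite P"
    and S: "underS r m = S" "\<not> |S| \<le>o |P|" "\<And>a. a \<in> S \<Longrightarrow> |underS r a| \<le>o |P|"
    and B: "B \<subseteq> S" "|S - B| \<le>o |P|"
  obtains c where "\<And>a. c a \<in> P" "\<And>p. p \<in> P \<Longrightarrow> \<not> small r P {a \<in> B. c a = p}"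
proof -
  have "\<forall>a\<in>S. \<exists>g. inj_on g (underS r a) \<and> g ` underS r a \<subseteq> P"
    using S(3) by (simp add: card_of_ordLeq)
  from bchoice[OF this] obtain g where g: "\<And>a. a \<in> S \<Longrightarrow> inj_on (g a) (underS r a)"
      "\<And>a. a \<in> S \<Longrightarrow> g a ` underS r a \<subseteq> P"
    by blast
  define U where "U b p = {a \<in> B. b \<in> underS r a \<and> g a b = p}" for b p
  have S_Field: "S \<subseteq> Field r"
    using S(1) underS_subset_Field[of r m] by blast
  \<comment> \<open>For fixed \<open>b\<close> the sets \<open>U b p\<close> cover the part of
    \<open>B\<close> above \<open>b\<close>, which is all of \<open>S\<close> up to at most
    \<open>|P|\<close> points. By completeness one of them is not small.\<close>
  have "\<exists>p\<in>P. \<not> small r P (U b p)" if b: "b \<in> S" for b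
  proof (rule ccontr)
    assume "\<not> (\<exists>p\<in>P. \<not> small r P (U b p))"
    then have "small r P (\<Union>p\<in>P. U b p)"
      using P by (intro small_UN card_of_ordLeq_self) auto
    moreover have "(\<Union>p\<in>P. U b p) = {a \<in> B. b \<in> underS r a}"
      using g(2) B(1) by (auto simp: U_def)
    moreover have "\<not> small r P {a \<in> B. b \<in> underS r a}"
    proof (rule not_small_if_co_small[OF r P S(1,2)])
      have "S - {a \<in> B. b \<in> underS r a} \<subseteq> (S - B) \<union> (underS r b \<union> {b})"
      proof
        fix a assume "a \<in> S - {a \<in> B. b \<in> underS r a}"
        moreover have "a = b \<or> a \<in> underS r b \<or> b \<in> underS r a" if "a \<in> S"
          using that b S_Field by (intro underS_total[OF r]) blast+
        ultimately show "a \<in> (S - B) \<union> (underS r b \<union> {b})" by blast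
      qed
      moreover have "|(S - B) \<union> (underS r b \<union> {b})| \<le>o |P|"
        using P B(2) S(3)[OF b] by (intro Un_ordLeq_infinite) (auto intro: finite_ordLeq_infinite)
      ultimately show "|S - {a \<in> B. b \<in> underS r a}| \<le>o |P|"
        by (rule subset_ordLeq)
    qed (use B in auto)
    ultimately show False by simp
  qed
  then have "\<forall>b\<in>S. \<exists>p. p \<in> P \<and> \<not> small r P (U b p)" by blast
  from bchoice[OF this] obtain p where
    p: "\<And>b. b \<in> S \<Longrightarrow> p b \<in> P" "\<And>b. b \<in> S \<Longrightarrow> \<not> small r P (U b (p b))"
    by blast
  \<comment> \<open>Pigeonhole: more than \<open>|P|\<close> many \<open>b\<close> share one index
    \<open>q\<close>. Their sets \<open>U b q\<close> are pairwise disjoint since \<open>g a\<close>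
    is injective, and \<open>\<iota>\<close> selects \<open>|P|\<close> of them as cores of the
    colour classes.\<close>
  have "\<exists>q\<in>P. \<not> |{b \<in> S. p b = q}| \<le>o |P|"
  proof (rule ccontr)
    assume "\<not> (\<exists>q\<in>P. \<not> |{b \<in> S. p b = q}| \<le>o |P| )"
    then have "|\<Union>q\<in>P. {b \<in> S. p b = q}| \<le>o |P|"
      using P by (intro card_of_UNION_ordLeq_infinite card_of_ordLeq_self) auto
    moreover have "(\<Union>q\<in>P. {b \<in> S. p b = q}) = S" using p(1) by auto
    ultimately show False using S(2) by simp
  qed
  then obtain q where q: "q \<in> P" "|P| \<le>o |{b \<in> S. p b = q}|"
    using ordLeq_total[OF card_of_Well_order card_of_Well_order] by blast
  then obtain \<iota> where \<iota>: "inj_on \<iota> P" "\<iota> ` P \<subseteq> {b \<in> S. p b = q}"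
    unfolding card_of_ordLeq[symmetric] by blast
  obtain p0 where p0: "p0 \<in> P" using P by fastforce
  \<comment> \<open>Points outside the selected sets get the default colour \<open>p0\<close>, which
    can only enlarge a class.\<close>
  define c where "c a = (if \<exists>s\<in>P. a \<in> U (\<iota> s) q then SOME s. s \<in> P \<and> a \<in> U (\<iota> s) q else p0)" for a
  have c: "c a \<in> P \<and> a \<in> U (\<iota> (c a)) q" if "\<exists>s\<in>P. a \<in> U (\<iota> s) q" for a
  proof -
    have "\<exists>s. s \<in> P \<and> a \<in> U (\<iota> s) q" using that by blast
    from someI_ex[OF this] show ?thesis using that by (simp add: c_def)
  qed
  show thesis
  proof
    show "c a \<in> P" for a
      using c[of a] p0 by (cases "\<exists>s\<in>P. a \<in> U (\<iota> s) q") (simp_all add: c_def)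
    fix s assume s: "s \<in> P"
    have "U (\<iota> s) q \<subseteq> {a \<in> B. c a = s}"
    proof
      fix a assume a: "a \<in> U (\<iota> s) q"
      then have *: "c a \<in> P" "a \<in> U (\<iota> (c a)) q" using c[of a] s by auto
      have "a \<in> S" using a B(1) by (auto simp: U_def)
      then have "\<iota> (c a) = \<iota> s"
        using a *(2) by (intro inj_onD[OF g(1)[of a]]) (auto simp: U_def)
      then have "c a = s" using *(1) s \<iota>(1) by (simp add: inj_on_def)
      then show "a \<in> {a \<in> B. c a = s}" using a by (auto simp: U_def)
    qed
    moreover have "\<not> small r P (U (\<iota> s) q)" using p(2)[of "\<iota> s"] \<iota>(2) s by auto
    ultimately show "\<not> small r P {a \<in> B. c a = s}" using small_subset by blast
  qed
qed

section \<open>Independent functions\<close>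

lemma Times_ordLeq_infinite:
  assumes "infinite C" "|A| \<le>o |C|" "|B| \<le>o |C|"
  shows "|A \<times> B| \<le>o |C|"
  using card_of_Times_ordLeq_infinite_Field[OF _ assms(2,3) card_of_Card_order] assms(1)
  by (simp add: Field_card_of)

lemma image_ordLeq:
  assumes "|A| \<le>o r"
  shows "|f ` A| \<le>o r"
  using card_of_image assms by (rule ordLeq_transitive)

lemma lists_ordLeq_infinite:
  assumes C: "infinite C" and A: "|A| \<le>o |C|"
  shows "|lists A| \<le>o |C|"
proof -
  have n: "|{xs \<in> lists A. length xs = n}| \<le>o |C|" for n
  proof (induction n)
    case 0
    have "{xs \<in> lists A. length xs = 0} = {[]}" by auto
    then show ?case using finite_ordLeq_infinite[of "{[]}" C] C by simp
  next
    case (Suc n)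
    have "{xs \<in> lists A. length xs = Suc n} \<subseteq>
        (\<lambda>(x, xs). x # xs) ` (A \<times> {xs \<in> lists A. length xs = n})"
      by (auto simp: length_Suc_conv image_iff)
    then show ?case
      by (rule subset_ordLeq) (intro image_ordLeq Times_ordLeq_infinite C A Suc)
  qed
  have "|\<Union>n. {xs \<in> lists A. length xs = n}| \<le>o |C|"
    using C n infinite_iff_card_of_nat[of C] by (intro card_of_UNION_ordLeq_infinite) auto
  moreover have "lists A \<subseteq> (\<Union>n. {xs \<in> lists A. length xs = n})" by blast
  ultimately show ?thesis by (rule subset_ordLeq[rotated])
qed

text \<open>One point of the symmetric difference is taken for each pair of distinct members. With a
  list instead of a set, traces are again lists over \<open>P\<close> and can be counted as
  such.\<close>

lemma finite_separating_list:
  assumes "finite T" "T \<subseteq> Pow P"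
  obtains s where "s \<in> lists P" "inj_on (\<lambda>\<tau>. filter (\<lambda>x. x \<in> \<tau>) s) T"
proof -
  define d where "d \<tau> \<tau>' = (SOME x. (x \<in> \<tau>) \<noteq> (x \<in> \<tau>'))" for \<tau> \<tau>' :: "'a set"
  have d: "(d \<tau> \<tau>' \<in> \<tau>) \<noteq> (d \<tau> \<tau>' \<in> \<tau>')" if "\<tau> \<noteq> \<tau>'" for \<tau> \<tau>'
  proof -
    have "\<exists>x. (x \<in> \<tau>) \<noteq> (x \<in> \<tau>')" using that by blast
    from someI_ex[OF this] show ?thesis by (simp add: d_def)
  qed
  define D where "D = (\<lambda>(\<tau>, \<tau>'). d \<tau> \<tau>') ` {p \<in> T \<times> T. fst p \<noteq> snd p}"
  have "finite D" using assms(1) by (auto simp: D_def)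
  then obtain s where s: "set s = D" using finite_list by blast
  show thesis
  proof
    have "d \<tau> \<tau>' \<in> P" if "\<tau> \<in> T" "\<tau>' \<in> T" "\<tau> \<noteq> \<tau>'" for \<tau> \<tau>'
      using d[OF that(3)] that(1,2) assms(2) by blast
    then have "D \<subseteq> P" unfolding D_def by clarsimp
    then show "s \<in> lists P" using s by auto
    show "inj_on (\<lambda>\<tau>. filter (\<lambda>x. x \<in> \<tau>) s) T"
    proof (rule inj_onI, rule ccontr)
      fix \<tau> \<tau>' assume *: "\<tau> \<in> T" "\<tau>' \<in> T" "filter (\<lambda>x. x \<in> \<tau>) s = filter (\<lambda>x. x \<in> \<tau>') s" "\<tau> \<noteq> \<tau>'"
      then have "(\<tau>, \<tau>') \<in> {p \<in> T \<times> T. fst p \<noteq> snd p}" by simp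
      then have "d \<tau> \<tau>' \<in> set s" unfolding s D_def by (rule rev_image_eqI) simp
      moreover have "set s \<inter> \<tau> = set s \<inter> \<tau>'"
        using arg_cong[OF *(3), of set] by auto
      ultimately show False using d[OF *(4)] by blast
    qed
  qed
qed

text \<open>The Engelking--Karlowicz theorem: a point codes a finite set \<open>s\<close> together with a
  prescription of a value for finitely many possible traces of \<open>\<tau>\<close> on \<open>s\<close>.\<close>

lemma independent_functions:
  fixes P :: "'a set"
  assumes P: "infinite P"
  shows "\<exists>h :: 'a set \<Rightarrow> 'a \<Rightarrow> 'a. \<forall>T v. finite T \<longrightarrow> T \<subseteq> Pow P \<longrightarrow> v ` T \<subseteq> P \<longrightarrow>
    (\<exists>q\<in>P. \<forall>\<tau>\<in>T. h \<tau> q = v \<tau>)"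
proof -
  \<comment> \<open>A code is a list \<open>s\<close> with an association list from traces on
    \<open>s\<close> to values. There are at most \<open>|P|\<close> codes, so \<open>dec\<close>
    lets the points of \<open>P\<close> stand for all of them.\<close>
  define Q where "Q = lists P \<times> lists (lists P \<times> P)"
  have "Q \<noteq> {}" by (auto simp: Q_def)
  have "|Q| \<le>o |P|"
    unfolding Q_def by (intro Times_ordLeq_infinite lists_ordLeq_infinite card_of_ordLeq_self P)
  then obtain dec where dec: "dec ` P = Q"
    unfolding card_of_ordLeq2[symmetric, OF \<open>Q \<noteq> {}\<close>] by blast
  define h where "h \<tau> q = (case dec q of (s, \<phi>) \<Rightarrow> the (map_of \<phi> (filter (\<lambda>x. x \<in> \<tau>) s)))" for \<tau> q
  show ?thesis
  proof (intro exI[of _ h] allI impI)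
    fix T v assume T: "finite T" "T \<subseteq> Pow P" "v ` T \<subseteq> P"
    obtain s where s: "s \<in> lists P" "inj_on (\<lambda>\<tau>. filter (\<lambda>x. x \<in> \<tau>) s) T"
      using T(1,2) by (rule finite_separating_list)
    obtain ts where ts: "set ts = T" using finite_list[OF T(1)] by blast
    define \<phi> where "\<phi> = map (\<lambda>\<tau>. (filter (\<lambda>x. x \<in> \<tau>) s, v \<tau>)) ts"
    \<comment> \<open>Since \<open>s\<close> separates \<open>T\<close>, distinct members have
      distinct keys, so the lookup returns the prescribed value.\<close>
    have \<phi>: "map_of \<phi> (filter (\<lambda>x. x \<in> \<tau>) s) = Some (v \<tau>)" if "\<tau> \<in> T" for \<tau>
    proof -
      have "map_of (map (\<lambda>\<tau>. (filter (\<lambda>x. x \<in> \<tau>) s, v \<tau>)) us) (filter (\<lambda>x. x \<in> \<tau>) s) = Some (v \<tau>)"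
        if "\<tau> \<in> set us" "set us \<subseteq> T" for us
        using that
      proof (induction us)
        case (Cons u us)
        then have "filter (\<lambda>x. x \<in> \<tau>) s = filter (\<lambda>x. x \<in> u) s \<longleftrightarrow> \<tau> = u"
          using inj_on_eq_iff[OF s(2), of \<tau> u] by auto
        then show ?case using Cons by (cases "\<tau> = u") auto
      qed simp
      then show ?thesis using ts that by (simp add: \<phi>_def)
    qed
    have "v \<tau> \<in> P" if "\<tau> \<in> set ts" for \<tau> using that T(3) ts by blast
    then have "(s, \<phi>) \<in> Q" using s(1) by (auto simp: Q_def \<phi>_def)
    then obtain q where "q \<in> P" "dec q = (s, \<phi>)"
      unfolding dec[symmetric] by (metis imageE)
    then show "\<exists>q\<in>P. \<forall>\<tau>\<in>T. h \<tau> q = v \<tau>"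
      using \<phi> by (intro bexI[of _ q]) (simp_all add: h_def)
  qed
qed

section \<open>A colouring of a limit cardinal\<close>

text \<open>For an infinite cardinal \<open>r\<close> this means being an uncountable limit
  cardinal. Smaller cardinals are represented by initial segments of \<open>r\<close>, so that no
  other type enters.\<close>

definition uncountable_limit :: "'a rel \<Rightarrow> bool"
  where "uncountable_limit r \<longleftrightarrow>
    (\<forall>k\<in>Field r. \<exists>m\<in>Field r. infinite (underS r m) \<and> \<not> |underS r m| \<le>o |underS r k| )"

lemma ordLess_card_underS:
  assumes "Well_order r" "|A| <o r"
  obtains a where "a \<in> Field r" "|A| \<le>o |underS r a|"
proof -
  obtain a where a: "a \<in> Field r" "|A| =o Restr r (underS r a)"
    using ordLess_iff_ordIso_Restr[OF assms(1) card_of_Well_order] assms(2) by blast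
  have "|Field |A| | \<le>o |Field (Restr r (underS r a))|"
    using ordIso_imp_ordLeq[OF a(2)] by (rule card_of_mono2)
  moreover have "Field (Restr r (underS r a)) \<subseteq> underS r a"
    by (auto simp: Field_def)
  ultimately have "|A| \<le>o |underS r a|"
    by (metis Field_card_of card_of_mono1 ordLeq_transitive)
  then show thesis using a(1) that by blast
qed

text \<open>Otherwise either all initial segments are finite or one of them bounds the sizes of all.
  As \<open>Field r\<close> is covered by the segments below a cofinal \<open>K\<close> with
  \<open>|K| <o r\<close>, it would be finite or of size less than \<open>r\<close>.\<close>

lemma singular_uncountable_limit:
  assumes "singular_card r"
  shows "uncountable_limit r"
proof -
  have inf: "infinite (Field r)" and r: "Card_order r"
    using assms by (auto simp: singular_card_def cinfinite_def)
  then have wr: "Well_order r" by (simp add: card_order_on_well_order_on)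
  have "Cinfinite r" using assms by (simp add: singular_card_def)
  from is_min_card_cofinality[OF this] obtain K where
    K: "K \<subseteq> Field r" "cofinal K r" "cofinality r = |K|"
    unfolding is_min_card_def by blast
  then have "|K| <o r" using assms unfolding singular_card_def by simp
  then obtain z where z: "z \<in> Field r" "|K| \<le>o |underS r z|"
    by (rule ordLess_card_underS[OF wr])
  have cover: "Field r \<subseteq> (\<Union>b\<in>K. underS r b)"
    using K(2) by (auto simp: cofinal_def underS_def)
  show ?thesis unfolding uncountable_limit_def
  proof (rule ballI, rule ccontr)
    fix k assume k: "k \<in> Field r"
      and *: "\<not> (\<exists>m\<in>Field r. infinite (underS r m) \<and> \<not> |underS r m| \<le>o |underS r k| )"
    show False
    proof (cases "finite (underS r k)")
      case True
      then have fin: "finite (underS r m)" if "m \<in> Field r" for m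
        using * that card_of_ordLeq_finite by blast
      then have "finite K" using z card_of_ordLeq_finite by blast
      then have "finite (\<Union>b\<in>K. underS r b)" using fin K(1) by blast
      then show False using cover inf finite_subset by blast
    next
      case False
      then have le: "|underS r m| \<le>o |underS r k|" if "m \<in> Field r" for m
        using * that finite_ordLeq_infinite by blast
      have "|\<Union>b\<in>K. underS r b| \<le>o |underS r k|"
        using False ordLeq_transitive[OF z(2) le[OF z(1)]] le K(1)
        by (intro card_of_UNION_ordLeq_infinite) auto
      with cover have "|Field r| \<le>o |underS r k|" by (rule subset_ordLeq)
      moreover have "|underS r k| <o |Field r|"
        using card_of_underS[OF r k] card_of_Field_ordIso[OF r] ordIso_symmetric
          ordLess_ordIso_trans by blast
      ultimately show False using not_ordLess_ordLeq by blast
    qed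
  qed
qed

lemma finite_set_bounded_by_member:
  assumes wr: "Well_order r" and "finite F" "F \<subseteq> Field r" "Field r \<noteq> {}"
  shows "\<exists>M\<in>Field r. F \<subseteq> insert M (underS r M)"
  using assms(2,3)
proof (induction F)
  case empty
  then show ?case using assms(4) by blast
next
  case (insert x F)
  then obtain M where M: "M \<in> Field r" "F \<subseteq> insert M (underS r M)" by blast
  have x: "x \<in> Field r" using insert.prems by blast
  show ?case
  proof (cases "x \<in> insert M (underS r M)")
    case True
    then show ?thesis using M by blast
  next
    case False
    then have "M \<in> underS r x" using underS_total[OF wr x M(1)] by blast
    then have "F \<subseteq> underS r x" using M(2) underS_trans[OF wr, of M x] by blast
    then show ?thesis using x by blast
  qed
qed

text \<open>When \<open>v\<close> is the code of a point \<open>x\<close> under \<open>t\<close>,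
  the images of the sets \<open>Hit t v - N\<close> under \<open>e x\<close> will generate the
  ultrafilter of \<open>x\<close>. The independence clause yields the finite intersection property.
  The last clause yields disjoint members, with one \<open>N\<close> serving all of \<open>C\<close>
  and every \<open>t\<close>.\<close>

lemma limit_colouring:
  fixes r :: "'a rel"
  assumes wr: "Well_order r" and lim: "uncountable_limit r" and ne: "Field r \<noteq> {}"
  shows "\<exists>(\<I> :: 'a set set) (Hit :: 'a set \<Rightarrow> 'a \<Rightarrow> 'a set).
    {} \<in> \<I> \<and> (\<forall>a. {a} \<in> \<I>) \<and> (\<forall>M\<in>\<I>. \<forall>N\<in>\<I>. M \<union> N \<in> \<I>) \<and> (\<forall>t v. Hit t v \<subseteq> Field r) \<and>
    (\<forall>T v N. finite T \<longrightarrow> T \<subseteq> Pow (Field r) \<longrightarrow> v ` T \<subseteq> Field r \<longrightarrow> N \<in> \<I> \<longrightarrow>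
      (\<exists>a. a \<notin> N \<and> (\<forall>t\<in>T. a \<in> Hit t (v t)))) \<and>
    (\<forall>(C :: 'x set) g (e :: 'x \<Rightarrow> 'a \<Rightarrow> 'y). inj_on g C \<longrightarrow> (\<forall>x\<in>C. inj_on (e x) (Field r)) \<longrightarrow>
      (\<exists>N\<in>\<I>. \<forall>x\<in>C. \<forall>y\<in>C. \<forall>t. \<forall>a\<in>Hit t (g x) - N. \<forall>b\<in>Hit t (g y) - N.
        e x a = e y b \<longrightarrow> x = y))"
proof -
  \<comment> \<open>The infinite cardinals below \<open>r\<close>, as points of
    \<open>r\<close>.\<close>
  define K where "K = {k \<in> Field r. infinite (underS r k) \<and>
    (\<forall>j\<in>underS r k. \<not> |underS r k| \<le>o |underS r j| )}"
  have K_Field: "k \<in> Field r" and K_inf: "infinite (underS r k)"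
    and K_initial: "\<And>j. j \<in> underS r k \<Longrightarrow> \<not> |underS r k| \<le>o |underS r j|" if "k \<in> K" for k
    using that by (auto simp: K_def)
  \<comment> \<open>The least \<open>m\<close> with an infinite segment larger than that of
    \<open>k\<close> is the successor cardinal of that segment, or omega if the segment is
    finite.\<close>
  have "\<exists>m. m \<in> Field r \<and> infinite (underS r m) \<and> \<not> |underS r m| \<le>o |underS r k| \<and>
      (\<forall>a\<in>underS r m. finite (underS r a) \<or> |underS r a| \<le>o |underS r k| )" if k: "k \<in> Field r" for k
  proof -
    define W where "W = {m \<in> Field r. infinite (underS r m) \<and> \<not> |underS r m| \<le>o |underS r k|}"
    have "W \<subseteq> Field r" "W \<noteq> {}" using lim k by (auto simp: W_def uncountable_limit_def)
    then obtain m where m: "m \<in> W" "underS r m \<inter> W = {}"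
      by (rule underS_minimal[OF wr])
    have "finite (underS r a) \<or> |underS r a| \<le>o |underS r k|" if "a \<in> underS r m" for a
    proof -
      have "a \<notin> W" "a \<in> Field r" using that m(2) underS_subset_Field[of r m] by blast+
      then show ?thesis by (auto simp: W_def)
    qed
    then show ?thesis using m(1) by (intro exI[of _ m]) (simp add: W_def)
  qed
  then have "\<forall>k\<in>Field r. \<exists>m. m \<in> Field r \<and> infinite (underS r m) \<and>
      \<not> |underS r m| \<le>o |underS r k| \<and>
      (\<forall>a\<in>underS r m. finite (underS r a) \<or> |underS r a| \<le>o |underS r k| )"
    by blast
  from bchoice[OF this] obtain m where m: "\<And>k. k \<in> Field r \<Longrightarrow> m k \<in> Field r"
    "\<And>k. k \<in> Field r \<Longrightarrow> infinite (underS r (m k))"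
    "\<And>k. k \<in> Field r \<Longrightarrow> \<not> |underS r (m k)| \<le>o |underS r k|"
    "\<And>k a. \<lbrakk>k \<in> Field r; a \<in> underS r (m k)\<rbrakk> \<Longrightarrow> finite (underS r a) \<or> |underS r a| \<le>o |underS r k|"
    by blast
  have m_above: "k \<in> underS r (m k)" if "k \<in> Field r" for k
  proof -
    have "\<not> underS r (m k) \<subseteq> underS r k" using m(3)[OF that] card_of_mono1 by blast
    then show ?thesis
      using underS_total[OF wr that m(1)[OF that]] underS_trans[OF wr, of "m k" k] by auto
  qed
  have mK: "m k \<in> K" if k: "k \<in> Field r" for k
  proof -
    have "\<not> |underS r (m k)| \<le>o |underS r j|" if "j \<in> underS r (m k)" for j
      using m(4)[OF k that]
    proof
      assume "|underS r j| \<le>o |underS r k|"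
      then show ?thesis using m(3)[OF k] ordLeq_transitive by blast
    next
      assume "finite (underS r j)"
      then show ?thesis using m(2)[OF k] card_of_ordLeq_finite by blast
    qed
    then show ?thesis using m(1,2)[OF k] by (simp add: K_def)
  qed
  \<comment> \<open>For \<open>k\<close> in \<open>K\<close> this is the block from \<open>k\<close>
    to its successor cardinal. By \<open>below\<close>, the successor of an earlier member of
    \<open>K\<close> is at most \<open>k\<close>, so the blocks are disjoint.\<close>
  define B where "B k = underS r (m k) - underS r k" for k
  have below: "b \<in> underS r k" if "j \<in> K" "k \<in> K" "j \<in> underS r k" "b \<in> underS r (m j)" for j k b
  proof -
    have "k \<notin> underS r (m j)"
    proof
      assume "k \<in> underS r (m j)"
      from m(4)[OF K_Field[OF that(1)] this] have "|underS r k| \<le>o |underS r j|"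
        using K_inf[OF that(2)] by blast
      then show False using K_initial[OF that(2,3)] by blast
    qed
    then have "m j = k \<or> m j \<in> underS r k"
      using underS_total[OF wr K_Field[OF that(2)] m(1)[OF K_Field[OF that(1)]]] by blast
    then show ?thesis using that(4) underS_trans[OF wr, of "m j" k b] by blast
  qed
  have "\<exists>c. (\<forall>p\<in>underS r k. \<not> small r (underS r k) {a \<in> B k. c a = p})" if k: "k \<in> K" for k
  proof -
    have 1: "|underS r a| \<le>o |underS r k|" if "a \<in> underS r (m k)" for a
      using m(4)[OF K_Field[OF k] that] K_inf[OF k] finite_ordLeq_infinite by blast
    have 2: "B k \<subseteq> underS r (m k)" "|underS r (m k) - B k| \<le>o |underS r k|"
      unfolding B_def by (auto intro: card_of_mono1)
    show ?thesis
      by (rule colouring_with_nonsmall_classes[OF wr K_inf[OF k] refl m(3)[OF K_Field[OF k]] 1 2])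
        blast+
  qed
  then have "\<forall>k\<in>K. \<exists>c. (\<forall>p\<in>underS r k. \<not> small r (underS r k) {a \<in> B k. c a = p})" by blast
  from bchoice[OF this] obtain c where
    c: "\<And>k p. \<lbrakk>k \<in> K; p \<in> underS r k\<rbrakk> \<Longrightarrow> \<not> small r (underS r k) {a \<in> B k. c k a = p}"
    by blast
  have "\<forall>k\<in>K. \<exists>h. \<forall>T v. finite T \<longrightarrow> T \<subseteq> Pow (underS r k) \<longrightarrow> v ` T \<subseteq> underS r k \<longrightarrow>
      (\<exists>q\<in>underS r k. \<forall>\<tau>\<in>T. h \<tau> q = v \<tau>)"
    using K_inf by (intro ballI independent_functions)
  from bchoice[OF this] obtain h where
    h: "\<forall>k\<in>K. \<forall>T v. finite T \<longrightarrow> T \<subseteq> Pow (underS r k) \<longrightarrow> v ` T \<subseteq> underS r k \<longrightarrow>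
      (\<exists>q\<in>underS r k. \<forall>\<tau>\<in>T. h k \<tau> q = v \<tau>)"
    by (rule exE)
  \<comment> \<open>In block \<open>k\<close> the colour of \<open>a\<close> is the argument of the
    independent function attached to the trace of \<open>t\<close>. Since \<open>v\<close> has to
    lie below \<open>k\<close>, only \<open>|underS r k|\<close> many codes compete in this
    block.\<close>
  define Hit where "Hit t v =
    {a. \<exists>k\<in>K. a \<in> B k \<and> v \<in> underS r k \<and> h k (t \<inter> underS r k) (c k a) = v}" for t v
  have Hit_Field: "Hit t v \<subseteq> Field r" for t v
  proof
    fix a assume "a \<in> Hit t v"
    then obtain k where "a \<in> underS r (m k)" by (auto simp: Hit_def B_def)
    then show "a \<in> Field r" using underS_subset_Field by (rule subsetD[rotated])
  qed
  define \<I> where "\<I> = {N. \<forall>k\<in>K. small r (underS r k) (N \<inter> B k)}"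
  show ?thesis
  proof (intro exI[of _ \<I>] exI[of _ Hit] conjI allI ballI impI)
    have "small r P {}" for P :: "'a set" by (simp add: small_def card_of_empty)
    then show "{} \<in> \<I>" by (simp add: \<I>_def)
  next
    fix a
    have "small r (underS r k) ({a} \<inter> B k)" if k: "k \<in> K" for k
    proof -
      obtain z where z: "z \<in> underS r k" using K_inf[OF k] by fastforce
      have "z \<in> underS r b" if "b \<in> B k" for b
      proof -
        have "b \<notin> underS r k" "b \<in> Field r"
          using that underS_subset_Field[of r "m k"] by (auto simp: B_def)
        then show ?thesis
          using underS_total[OF wr _ K_Field[OF k], of b] z underS_trans[OF wr, of k b z] by blast
      qed
      moreover have "|{a} \<inter> B k| \<le>o |underS r k|"
        using K_inf[OF k] by (intro finite_ordLeq_infinite) auto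
      ultimately show ?thesis by (intro small_if_bounded[of _ _ z]) auto
    qed
    then show "{a} \<in> \<I>" by (simp add: \<I>_def)
  next
    fix M N assume "M \<in> \<I>" "N \<in> \<I>"
    then show "M \<union> N \<in> \<I>"
      using K_inf by (auto simp: \<I>_def Int_Un_distrib2 intro: small_Un)
  next
    show "Hit t v \<subseteq> Field r" for t v by (rule Hit_Field)
  next
    fix T v N assume T: "finite T" "T \<subseteq> Pow (Field r)" "v ` T \<subseteq> Field r" and N: "N \<in> \<I>"
    \<comment> \<open>The block \<open>k\<close> is chosen above all values of \<open>v\<close> and
      above a finite list separating \<open>T\<close>, so the members of \<open>T\<close> keep
      distinct traces below \<open>k\<close>. Independence gives a colour \<open>q\<close> that
      suits all of \<open>T\<close>, and its class is not small, hence not covered by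
      \<open>N\<close>.\<close>
    obtain s where s: "s \<in> lists (Field r)" "inj_on (\<lambda>t. filter (\<lambda>x. x \<in> t) s) T"
      using T(1,2) by (rule finite_separating_list)
    have "finite (set s \<union> v ` T)" "set s \<union> v ` T \<subseteq> Field r" using s(1) T by auto
    then obtain k0 where k0: "k0 \<in> Field r" "set s \<union> v ` T \<subseteq> insert k0 (underS r k0)"
      using finite_set_bounded_by_member[OF wr _ _ ne] by blast
    define k where "k = m k0"
    have k: "k \<in> K" using mK[OF k0(1)] by (simp add: k_def)
    have "insert k0 (underS r k0) \<subseteq> underS r k"
      using m_above[OF k0(1)] underS_trans[OF wr m_above[OF k0(1)]] by (auto simp: k_def)
    then have sk: "set s \<subseteq> underS r k" "v ` T \<subseteq> underS r k" using k0(2) by blast+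
    have inj: "inj_on (\<lambda>t. t \<inter> underS r k) T"
    proof (rule inj_onI)
      fix t t' assume t: "t \<in> T" "t' \<in> T" "t \<inter> underS r k = t' \<inter> underS r k"
      then have "filter (\<lambda>x. x \<in> t) s = filter (\<lambda>x. x \<in> t') s"
        using sk(1) by (intro filter_cong) auto
      then show "t = t'" by (rule inj_onD[OF s(2) _ t(1,2)])
    qed
    define w where "w \<tau> = v (inv_into T (\<lambda>t. t \<inter> underS r k) \<tau>)" for \<tau>
    have w: "w (t \<inter> underS r k) = v t" if "t \<in> T" for t
      using inv_into_f_f[OF inj that] by (simp add: w_def)
    have "\<exists>q\<in>underS r k. \<forall>\<tau>\<in>(\<lambda>t. t \<inter> underS r k) ` T. h k \<tau> q = w \<tau>"
      using T(1) sk(2) w by (intro h[rule_format, OF k]) auto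
    then obtain q where q: "q \<in> underS r k" "\<And>t. t \<in> T \<Longrightarrow> h k (t \<inter> underS r k) q = v t"
      by (auto simp: w)
    have "\<not> {a \<in> B k. c k a = q} \<subseteq> N \<inter> B k"
      using c[OF k q(1)] N k small_subset unfolding \<I>_def by blast
    then obtain a where a: "a \<in> B k" "c k a = q" "a \<notin> N" by blast
    have "a \<in> Hit t (v t)" if "t \<in> T" for t
      unfolding Hit_def using a k sk(2) q(2)[OF that] that by blast
    then show "\<exists>a. a \<notin> N \<and> (\<forall>t\<in>T. a \<in> Hit t (v t))" using a(3) by blast
  next
    fix C :: "'x set" and g :: "'x \<Rightarrow> 'a" and e :: "'x \<Rightarrow> 'a \<Rightarrow> 'y"
    assume g: "inj_on g C" and inj: "\<forall>x\<in>C. inj_on (e x) (Field r)"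
    have e: "inj_on (e x) (Field r)" if "x \<in> C" for x using inj that by blast
    \<comment> \<open>\<open>E x y k\<close> collects the indices in block \<open>k\<close> that
      collide with a smaller index. \<open>N\<close> discards them for all pairs with codes below
      \<open>k\<close>; there are at most \<open>|underS r k|\<close> such pairs.\<close>
    define E where "E x y k = {a \<in> B k. \<exists>b\<in>underS r a. e x a = e y b}" for x y k
    define Ck where "Ck k = {x \<in> C. g x \<in> underS r k}" for k
    define N where "N = (\<Union>k\<in>K. \<Union>p\<in>Ck k \<times> Ck k. E (fst p) (snd p) k)"
    have B_disj: "j = k" if "a \<in> B j" "a \<in> B k" "j \<in> K" "k \<in> K" for j k a
      using that below[of j k a] below[of k j a] underS_total[OF wr K_Field K_Field, of j k]
      by (auto simp: B_def)
    \<comment> \<open>Sending \<open>a\<close> to a smaller collision partner is regressive, and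
      injective because the partner determines \<open>e x a\<close>.\<close>
    have E_small: "small r (underS r k) (E x y k)" if "k \<in> K" "x \<in> C" for x y k
    proof -
      define f where "f a = (SOME b. b \<in> underS r a \<and> e x a = e y b)" for a
      have f: "f a \<in> underS r a \<and> e x a = e y (f a)" if "a \<in> E x y k" for a
      proof -
        have "\<exists>b. b \<in> underS r a \<and> e x a = e y b" using that by (auto simp: E_def)
        from someI_ex[OF this] show ?thesis by (simp add: f_def)
      qed
      have "E x y k \<subseteq> Field r"
        using underS_subset_Field[of r "m k"] by (auto simp: E_def B_def)
      then have "inj_on (e x) (E x y k)" using e[OF that(2)] by (rule inj_on_subset[rotated])
      then have "inj_on f (E x y k)"
      proof (rule inj_onI[OF inj_onD])
        fix a a' assume "a \<in> E x y k" "a' \<in> E x y k" "f a = f a'"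
        then show "e x a = e x a'" "a \<in> E x y k" "a' \<in> E x y k"
          using f[of a] f[of a'] by simp_all
      qed
      then show ?thesis
        by (rule small_inj[OF K_inf[OF that(1)]]) (rule f[THEN conjunct1])
    qed
    have "N \<in> \<I>" unfolding \<I>_def
    proof (intro CollectI ballI)
      fix k assume k: "k \<in> K"
      have "inj_on g (Ck k)" "g ` Ck k \<subseteq> underS r k"
        using g by (auto simp: Ck_def inj_on_def)
      then have "|Ck k| \<le>o |underS r k|" unfolding card_of_ordLeq[symmetric] by blast
      then have "|Ck k \<times> Ck k| \<le>o |underS r k|"
        by (intro Times_ordLeq_infinite K_inf[OF k])
      moreover have "small r (underS r k) (E (fst p) (snd p) k)" if "p \<in> Ck k \<times> Ck k" for p
        using that by (intro E_small[OF k]) (auto simp: Ck_def)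
      ultimately have "small r (underS r k) (\<Union>p\<in>Ck k \<times> Ck k. E (fst p) (snd p) k)"
        by (intro small_UN[OF K_inf[OF k]])
      moreover have "N \<inter> B k \<subseteq> (\<Union>p\<in>Ck k \<times> Ck k. E (fst p) (snd p) k)"
      proof
        fix a assume "a \<in> N \<inter> B k"
        then obtain j p where "j \<in> K" "p \<in> Ck j \<times> Ck j" "a \<in> E (fst p) (snd p) j" "a \<in> B k"
          unfolding N_def by blast
        moreover from this have "j = k" using k by (intro B_disj[of a]) (auto simp: E_def)
        ultimately show "a \<in> (\<Union>p\<in>Ck k \<times> Ck k. E (fst p) (snd p) k)" by blast
      qed
      ultimately show "small r (underS r k) (N \<inter> B k)" by (rule small_subset)
    qed
    \<comment> \<open>The smaller index lies in the same or an earlier block, so \<open>g y\<close>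
      is below \<open>k\<close> as well and \<open>N\<close> has dealt with this pair.\<close>
    moreover have no: False if that': "a \<in> Hit t (g x) - N" "b \<in> Hit t (g y)" "e x a = e y b"
      "b \<in> underS r a" "x \<in> C" "y \<in> C" for a b x y t
    proof -
      obtain k where k: "k \<in> K" "a \<in> B k" "g x \<in> underS r k" using that'(1) by (auto simp: Hit_def)
      obtain j where j: "j \<in> K" "b \<in> B j" "g y \<in> underS r j" using that'(2) by (auto simp: Hit_def)
      have "k \<notin> underS r j"
      proof
        assume "k \<in> underS r j"
        then have "a \<in> underS r j" using below[OF k(1) j(1)] k(2) by (simp add: B_def)
        then have "b \<in> underS r j" using underS_trans[OF wr _ that'(4)] by blast
        then show False using j(2) by (simp add: B_def)
      qed
      then have "j = k \<or> j \<in> underS r k"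
        using underS_total[OF wr K_Field[OF j(1)] K_Field[OF k(1)]] by blast
      then have "g y \<in> underS r k" using j(3) underS_trans[OF wr, of j k] by blast
      then have "(x, y) \<in> Ck k \<times> Ck k" using that'(5,6) k(3) by (simp add: Ck_def)
      moreover have "a \<in> E x y k" using k(2) that'(3,4) by (auto simp: E_def)
      ultimately have "a \<in> N" unfolding N_def using k(1)
        by (intro UN_I[OF k(1)] UN_I[of "(x, y)"]) simp_all
      then show False using that'(1) by blast
    qed
    moreover have "x = y" if xy: "x \<in> C" "y \<in> C" and a: "a \<in> Hit t (g x) - N"
      and b: "b \<in> Hit t (g y) - N" and eq: "e x a = e y b" for x y t a b
    proof -
      have "a \<in> Field r" "b \<in> Field r" using a b Hit_Field by blast+
      then consider "a = b" | "b \<in> underS r a" | "a \<in> underS r b"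
        using underS_total[OF wr] by blast
      then show ?thesis
      proof cases
        \<comment> \<open>At a common index both codes are the value of the same function at the
          same colour.\<close>
        case 1
        obtain k where k: "k \<in> K" "a \<in> B k" "h k (t \<inter> underS r k) (c k a) = g x"
          using a by (auto simp: Hit_def)
        obtain j where j: "j \<in> K" "a \<in> B j" "h j (t \<inter> underS r j) (c j a) = g y"
          using b 1 by (auto simp: Hit_def)
        have "j = k" by (rule B_disj[OF j(2) k(2) j(1) k(1)])
        then have "g x = g y" using k(3) j(3) by simp
        then show ?thesis by (rule inj_onD[OF g _ xy])
      next
        case 2
        show ?thesis using no[OF a _ eq 2 xy] b by blast
      next
        case 3
        show ?thesis using no[OF b _ eq[symmetric] 3 xy(2,1)] a by blast
      qed
    qed
    ultimately show "\<exists>N\<in>\<I>. \<forall>x\<in>C. \<forall>y\<in>C. \<forall>t. \<forall>a\<in>Hit t (g x) - N. \<forall>b\<in>Hit t (g y) - N.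
          e x a = e y b \<longrightarrow> x = y"
      by (intro bexI[of _ N] ballI allI impI)
  qed
qed

section \<open>Ultrafilters\<close>

definition ultra :: "'x set set \<Rightarrow> bool"
  where "ultra D \<longleftrightarrow> {} \<notin> D \<and> (\<forall>S\<in>D. \<forall>T\<in>D. S \<inter> T \<in> D) \<and> (\<forall>S\<in>D. \<forall>T. S \<subseteq> T \<longrightarrow> T \<in> D)
    \<and> (\<forall>S. S \<in> D \<or> - S \<in> D)"

lemma ultra_Int_iff: "ultra D \<Longrightarrow> S \<inter> T \<in> D \<longleftrightarrow> S \<in> D \<and> T \<in> D"
  unfolding ultra_def by (meson Int_lower1 Int_lower2)

lemma ultra_mono: "\<lbrakk>ultra D; S \<in> D; S \<subseteq> T\<rbrakk> \<Longrightarrow> T \<in> D"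
  unfolding ultra_def by blast

lemma ultra_disjoint: "\<lbrakk>ultra D; S \<in> D; S \<inter> T = {}\<rbrakk> \<Longrightarrow> T \<notin> D"
  unfolding ultra_def by metis

lemma ultra_Compl_iff: "ultra D \<Longrightarrow> - S \<in> D \<longleftrightarrow> S \<notin> D"
  unfolding ultra_def by (metis Compl_disjoint)

text \<open>Zorn's lemma gives a maximal family with the finite intersection property. By maximality
  it contains every set that meets all its finite intersections (\<open>memI\<close>), and the
  ultrafilter axioms follow.\<close>

lemma ultra_exists:
  assumes fip: "\<And>F. \<lbrakk>finite F; F \<subseteq> B\<rbrakk> \<Longrightarrow> \<Inter>F \<noteq> {}"
  obtains D where "ultra D" "B \<subseteq> D"
proof -
  define good where "good A \<longleftrightarrow> B \<subseteq> A \<and> (\<forall>F. finite F \<longrightarrow> F \<subseteq> A \<longrightarrow> \<Inter>F \<noteq> {})" for A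
  have "\<exists>D\<in>Collect good. \<forall>A\<in>Collect good. D \<subseteq> A \<longrightarrow> A = D"
  proof (rule subset_Zorn_nonempty)
    show "Collect good \<noteq> {}" using fip unfolding good_def by blast
    fix C assume C: "C \<noteq> {}" "subset.chain (Collect good) C"
    have "\<Inter>F \<noteq> {}" if F: "finite F" "F \<subseteq> \<Union>C" for F
    proof -
      obtain A where "A \<in> C" "F \<subseteq> A"
        using finite_subset_Union_chain[OF F C(1,2)] by blast
      then show ?thesis using F(1) C(2) unfolding good_def subset.chain_def by blast
    qed
    moreover have "B \<subseteq> \<Union>C"
      using C unfolding good_def subset.chain_def by blast
    ultimately show "\<Union>C \<in> Collect good" by (simp add: good_def)
  qed
  then obtain D where D: "good D" "\<And>A. good A \<Longrightarrow> D \<subseteq> A \<Longrightarrow> A = D" by blast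
  have fipD: "\<Inter>F \<noteq> {}" if "finite F" "F \<subseteq> D" for F
    using that D(1) by (simp add: good_def)
  have memI: "S \<in> D" if S: "\<And>F. finite F \<Longrightarrow> F \<subseteq> D \<Longrightarrow> S \<inter> \<Inter>F \<noteq> {}" for S
  proof -
    have "\<Inter>F \<noteq> {}" if F: "finite F" "F \<subseteq> insert S D" for F
    proof -
      have "S \<inter> \<Inter>(F - {S}) \<noteq> {}" using F by (intro S) auto
      then show ?thesis by blast
    qed
    moreover have "B \<subseteq> insert S D" using D(1) unfolding good_def by blast
    ultimately have "good (insert S D)" unfolding good_def by blast
    from D(2)[OF this] show ?thesis by blast
  qed
  have "{} \<notin> D" using fipD[of "{{}}"] by auto
  moreover have "S \<inter> T \<in> D" if "S \<in> D" "T \<in> D" for S T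
  proof (rule memI)
    fix F assume "finite F" "F \<subseteq> D"
    then show "S \<inter> T \<inter> \<Inter>F \<noteq> {}" using fipD[of "insert S (insert T F)"] that by (simp add: Int_assoc)
  qed
  moreover have "T \<in> D" if "S \<in> D" "S \<subseteq> T" for S T
  proof (rule memI)
    fix F assume "finite F" "F \<subseteq> D"
    then show "T \<inter> \<Inter>F \<noteq> {}" using fipD[of "insert S F"] that by auto
  qed
  moreover have "S \<in> D \<or> - S \<in> D" for S
  proof (rule ccontr)
    assume "\<not> (S \<in> D \<or> - S \<in> D)"
    then obtain F G where F: "finite F" "F \<subseteq> D" "S \<inter> \<Inter>F = {}"
      and G: "finite G" "G \<subseteq> D" "- S \<inter> \<Inter>G = {}"
      using memI[of S] memI[of "- S"] by blast
    then have "\<Inter>(F \<union> G) = {}" by blast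
    then show False using fipD[of "F \<union> G"] F G by blast
  qed
  ultimately have "ultra D" unfolding ultra_def by blast
  then show thesis using that D(1) by (simp add: good_def)
qed

section \<open>Coding and enumeration\<close>

lemma Pow_ordLeq_Pow:
  assumes "|A| \<le>o |B|"
  shows "|Pow A| \<le>o |Pow B|"
proof -
  obtain f where "inj_on f A" "f ` A \<subseteq> B" using assms unfolding card_of_ordLeq[symmetric] by blast
  then have "inj_on ((`) f) (Pow A)" "(`) f ` Pow A \<subseteq> Pow B"
    by (auto intro: inj_on_image_Pow)
  then show ?thesis unfolding card_of_ordLeq[symmetric] by blast
qed

text \<open>Through a pairing, a single \<open>t\<close> stores two relations on \<open>L\<close>:
  the rows of \<open>A\<close> encode points of \<open>K\<close> that separate the members of
  \<open>C\<close>, and the rows of \<open>B\<close> are the traces of these members on those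
  points. The code of \<open>x\<close> is the label of a row of \<open>B\<close> that matches
  \<open>x\<close>.\<close>

lemma separating_codes:
  fixes L :: "'a set" and K :: "'k set"
  assumes L: "infinite L" and K: "|K| \<le>o |Pow L|"
  obtains g :: "'a set \<Rightarrow> 'k set \<Rightarrow> 'a"
  where "\<forall>t x. g t x \<in> L"
    and "\<forall>C\<subseteq>Pow K. |C| \<le>o |L| \<longrightarrow> (\<exists>t\<subseteq>L. inj_on (g t) C)"
proof -
  obtain l0 where l0: "l0 \<in> L" using L by fastforce
  obtain \<iota> where \<iota>: "inj_on \<iota> K" "\<iota> ` K \<subseteq> Pow L"
    using K unfolding card_of_ordLeq[symmetric] by blast
  have "|(L \<times> L) \<times> (UNIV :: bool set)| \<le>o |L|"
    using L by (intro Times_ordLeq_infinite card_of_ordLeq_self finite_ordLeq_infinite) auto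
  moreover have ne: "(L \<times> L) \<times> (UNIV :: bool set) \<noteq> {}" using l0 by auto
  ultimately obtain s where s: "s ` L = (L \<times> L) \<times> (UNIV :: bool set)"
    unfolding card_of_ordLeq2[symmetric, OF ne] by blast
  \<comment> \<open>\<open>M True t\<close> and \<open>M False t\<close> recover \<open>A\<close>
    and \<open>B\<close> from \<open>t\<close>; \<open>z\<close> decodes a row of \<open>A\<close>
    to a point of \<open>K\<close>, and \<open>ok\<close> says that row \<open>\<gamma>\<close> of
    \<open>B\<close> matches \<open>x\<close>.\<close>
  define M where "M i t = {p. \<exists>l\<in>t. s l = (p, i)}" for i and t :: "'a set"
  define z where "z A \<delta> = inv_into K \<iota> {\<epsilon>. (\<delta>, \<epsilon>) \<in> A}" for A and \<delta> :: 'a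
  define ok where "ok t x \<gamma> \<longleftrightarrow> \<gamma> \<in> L \<and> (\<forall>\<delta>\<in>L. z (M True t) \<delta> \<in> x \<longleftrightarrow> (\<gamma>, \<delta>) \<in> M False t)" for t x \<gamma>
  define g where "g t x = (if \<exists>\<gamma>. ok t x \<gamma> then SOME \<gamma>. ok t x \<gamma> else l0)" for t x
  have g_ok: "ok t x (g t x)" if "\<exists>\<gamma>. ok t x \<gamma>" for t x
    using someI_ex[OF that] that by (simp add: g_def)
  show thesis
  proof (rule that; intro allI impI)
    show "g t x \<in> L" for t x
    proof (cases "\<exists>\<gamma>. ok t x \<gamma>")
      case True
      from g_ok[OF this] show ?thesis by (simp add: ok_def)
    qed (simp add: g_def l0)
  next
    fix C assume C: "C \<subseteq> Pow K" "|C| \<le>o |L|"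
    then obtain \<phi> where \<phi>: "inj_on \<phi> C" "\<phi> ` C \<subseteq> L"
      unfolding card_of_ordLeq[symmetric] by blast
    define d where "d p = (SOME k. (k \<in> fst p) \<noteq> (k \<in> snd p))" for p :: "'k set \<times> 'k set"
    have d: "(d (u, v) \<in> u) \<noteq> (d (u, v) \<in> v)" if "u \<noteq> v" for u v
    proof -
      have "\<exists>k. (k \<in> u) \<noteq> (k \<in> v)" using that by blast
      from someI_ex[OF this] show ?thesis by (simp add: d_def)
    qed
    \<comment> \<open>One point of difference for each pair from \<open>C\<close>, hence at most
      \<open>|L|\<close> points in all.\<close>
    define Z where "Z = d ` {p \<in> C \<times> C. fst p \<noteq> snd p}"
    have dZ: "d (u, v) \<in> Z" if "u \<in> C" "v \<in> C" "u \<noteq> v" for u v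
      unfolding Z_def using that by (intro imageI) simp
    have "Z \<subseteq> K"
    proof
      fix k assume "k \<in> Z"
      then obtain p where "p \<in> C \<times> C" "fst p \<noteq> snd p" "k = d p" unfolding Z_def by blast
      then obtain u v where uv: "u \<in> C" "v \<in> C" "u \<noteq> v" "k = d (u, v)"
        by (metis mem_Times_iff prod.collapse)
      then show "k \<in> K" using d[OF uv(3)] C(1) by blast
    qed
    have "|{p \<in> C \<times> C. fst p \<noteq> snd p}| \<le>o |L|"
      by (rule subset_ordLeq[of _ "C \<times> C"], blast, intro Times_ordLeq_infinite L C)
    then have "|Z| \<le>o |L|" unfolding Z_def by (rule image_ordLeq)
    have "\<exists>A\<subseteq>L \<times> L. Z \<subseteq> z A ` L"
    proof (cases "Z = {}")
      case False
      obtain f where f: "f ` L = Z"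
        using \<open>|Z| \<le>o |L|\<close> unfolding card_of_ordLeq2[symmetric, OF False] by blast
      define A where "A = {(\<delta>, \<epsilon>). \<delta> \<in> L \<and> \<epsilon> \<in> \<iota> (f \<delta>)}"
      have fK: "f \<delta> \<in> K" if "\<delta> \<in> L" for \<delta> using that f \<open>Z \<subseteq> K\<close> by blast
      have "z A \<delta> = f \<delta>" if "\<delta> \<in> L" for \<delta>
      proof -
        have "{\<epsilon>. (\<delta>, \<epsilon>) \<in> A} = \<iota> (f \<delta>)" using that by (simp add: A_def)
        then show ?thesis using inv_into_f_f[OF \<iota>(1) fK[OF that]] by (simp add: z_def)
      qed
      then have "z A ` L = Z" using f by auto
      moreover have "A \<subseteq> L \<times> L" using fK \<iota>(2) unfolding A_def by blast
      ultimately show ?thesis by blast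
    qed blast
    then obtain A where A: "A \<subseteq> L \<times> L" "Z \<subseteq> z A ` L" by blast
    define B where "B = {(\<gamma>, \<delta>). \<delta> \<in> L \<and> (\<exists>x\<in>C. \<gamma> = \<phi> x \<and> z A \<delta> \<in> x)}"
    have B: "B \<subseteq> L \<times> L" using \<phi>(2) by (auto simp: B_def)
    define t where "t = {l \<in> L. fst (s l) \<in> (if snd (s l) then A else B)}"
    have M_eq: "M i t = (if i then A else B)" for i
    proof
      show "M i t \<subseteq> (if i then A else B)" by (auto simp: M_def t_def split: if_splits)
      show "(if i then A else B) \<subseteq> M i t"
      proof
        fix p assume p: "p \<in> (if i then A else B)"
        then have "(p, i) \<in> s ` L" unfolding s using A(1) B by (auto split: if_splits)
        then obtain l where "l \<in> L" "s l = (p, i)" by (auto simp: image_iff)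
        then show "p \<in> M i t" using p by (auto simp: M_def t_def intro!: bexI[of _ l])
      qed
    qed
    \<comment> \<open>So each member of \<open>C\<close> has a matching row. The row selected by
      \<open>g t\<close> may differ from \<open>\<phi> x\<close>, but members sharing a matching row
      have the same trace on \<open>Z\<close> and therefore coincide.\<close>
    have ok: "ok t x (\<phi> x)" if "x \<in> C" for x
      using that \<phi> unfolding ok_def M_eq B_def by (auto dest: inj_onD)
    have "inj_on (g t) C"
    proof (rule inj_onI, rule ccontr)
      fix u v assume uv: "u \<in> C" "v \<in> C" "g t u = g t v" "u \<noteq> v"
      have "ok t u (g t u)" "ok t v (g t u)"
        using g_ok ok uv(1) ok[OF uv(2)] uv(3) by (metis, metis)
      then have "z A \<delta> \<in> u \<longleftrightarrow> z A \<delta> \<in> v" if "\<delta> \<in> L" for \<delta>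
        using that unfolding ok_def M_eq by simp
      moreover obtain \<delta> where "\<delta> \<in> L" "d (u, v) = z A \<delta>" using dZ[OF uv(1,2,4)] A(2) by blast
      ultimately show False using d[OF uv(4)] by simp
    qed
    then show "\<exists>t\<subseteq>L. inj_on (g t) C" by (intro exI[of _ t]) (auto simp: t_def)
  qed
qed

text \<open>Regularity of a successor cardinal: at most \<open>|L|\<close> segments of size at most
  \<open>|L|\<close> cannot cover it.\<close>

lemma cardSuc_bounded:
  assumes L: "infinite L" and F: "F \<subseteq> Field (cardSuc |L| )" "|F| \<le>o |L|"
  obtains s where "s \<in> Field (cardSuc |L| )" "F \<subseteq> underS (cardSuc |L| ) s"
proof -
  let ?r = "cardSuc |L|"
  have co: "Card_order ?r" by (intro cardSuc_Card_order card_of_Card_order)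
  then have wr: "Well_order ?r" by (rule card_order_on_well_order_on)
  have "|insert f (underS ?r f)| \<le>o |L|" if "f \<in> F" for f
  proof -
    have "|underS ?r f| <o ?r" using card_of_underS[OF co] that F(1) by blast
    then have "|underS ?r f| \<le>o |L|"
      using cardSuc_ordLeq_ordLess[OF card_of_Card_order card_of_Card_order] by blast
    then have "|{f} \<union> underS ?r f| \<le>o |L|"
      using finite_ordLeq_infinite[of "{f}", OF _ L] by (intro Un_ordLeq_infinite[OF L]) simp_all
    then show ?thesis by simp
  qed
  then have "|\<Union>f\<in>F. insert f (underS ?r f)| \<le>o |L|"
    by (intro card_of_UNION_ordLeq_infinite L F(2)) blast
  moreover have "\<not> |Field ?r| \<le>o |L|"
    using cardSuc_greater[OF card_of_Card_order[of L]] card_of_Field_ordIso[OF co]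
      not_ordLess_ordLeq ordLess_ordIso_trans ordIso_symmetric by blast
  ultimately have "\<not> Field ?r \<subseteq> (\<Union>f\<in>F. insert f (underS ?r f))"
    using subset_ordLeq by blast
  then obtain s where s: "s \<in> Field ?r" "s \<notin> (\<Union>f\<in>F. insert f (underS ?r f))" by blast
  have "f \<in> underS ?r s" if "f \<in> F" for f
    using underS_total[OF wr s(1), of f] s(2) that F(1) by blast
  then show thesis using s(1) that by blast
qed

text \<open>Points of \<open>Pow K\<close> decode to triples of a function from \<open>L\<close> to
  \<open>Pow K\<close>, a label in \<open>Pow K\<close>, and a rank below the successor of
  \<open>|L|\<close>; there are enough points because \<open>|L| \<le>o |K|\<close>. Labels provide
  the multiplicity, ranks the well-foundedness.\<close>

lemma well_founded_enumeration:
  fixes L :: "'a set" and K :: "'k set"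
  assumes L: "infinite L" and LK: "|L| \<le>o |K|"
  obtains en :: "'k set \<Rightarrow> 'a \<Rightarrow> 'k set" and Dom :: "'k set set" and R :: "'k set rel"
  where "wf R"
    and "Dom \<subseteq> Pow K"
    and "\<forall>x\<in>Dom. inj_on (en x) L"
    and "\<forall>x\<in>Dom. en x ` L \<subseteq> Pow K"
    and "\<forall>x\<in>Dom. \<forall>a\<in>L. (en x a, x) \<in> R"
    and "\<forall>A\<subseteq>Pow K. |L| \<le>o |A| \<longrightarrow> |Pow K| \<le>o |{x \<in> Dom. en x ` L \<subseteq> A}|"
proof -
  let ?r = "cardSuc |L|" and ?X = "Pow K"
  let ?F = "Func L ?X"
  have K: "infinite K" using L LK card_of_ordLeq_finite by blast
  then have X: "infinite ?X" by simp
  have co: "Card_order ?r" by (intro cardSuc_Card_order card_of_Card_order)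
  then have wr: "Well_order ?r" by (rule card_order_on_well_order_on)
  have "inj_on (\<lambda>f. {(l, k). l \<in> L \<and> k \<in> f l}) ?F"
  proof (rule inj_onI)
    fix f g assume f: "f \<in> ?F" and g: "g \<in> ?F"
      and eq: "{(l, k). l \<in> L \<and> k \<in> f l} = {(l, k). l \<in> L \<and> k \<in> g l}"
    show "f = g"
    proof
      fix l show "f l = g l"
      proof (cases "l \<in> L")
        case True
        then show ?thesis using eq by (auto simp: set_eq_iff)
      qed (use f g in \<open>simp add: Func_def\<close>)
    qed
  qed
  moreover have "(\<lambda>f. {(l, k). l \<in> L \<and> k \<in> f l}) ` ?F \<subseteq> Pow (L \<times> K)"
    by (auto simp: Func_def)
  ultimately have "|?F| \<le>o |Pow (L \<times> K)|" unfolding card_of_ordLeq[symmetric] by blast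
  moreover have "|Pow (L \<times> K)| \<le>o |?X|"
    by (intro Pow_ordLeq_Pow Times_ordLeq_infinite K LK card_of_ordLeq_self)
  ultimately have F: "|?F| \<le>o |?X|" by (rule ordLeq_transitive)
  have "?r \<le>o |Pow L|"
    by (intro cardSuc_least card_of_Card_order card_of_Pow)
  then have "?r \<le>o |?X|" using Pow_ordLeq_Pow[OF LK] by (rule ordLeq_transitive)
  then have S: "|Field ?r| \<le>o |?X|"
    using card_of_Field_ordIso[OF co] ordIso_ordLeq_trans by blast
  have "|?F \<times> ?X \<times> Field ?r| \<le>o |?X|"
    by (intro Times_ordLeq_infinite X F S card_of_ordLeq_self)
  moreover have ne: "?F \<times> ?X \<times> Field ?r \<noteq> {}"
  proof -
    have "{} \<subseteq> Field ?r" "|{} :: 'a set set| \<le>o |L|" by (simp_all add: card_of_empty)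
    then obtain s where "s \<in> Field ?r" by (rule cardSuc_bounded[OF L])
    moreover have "(\<lambda>l. if l \<in> L then {} else undefined) \<in> ?F" by (simp add: Func_def)
    ultimately show ?thesis by blast
  qed
  ultimately obtain dec where dec: "dec ` ?X = ?F \<times> ?X \<times> Field ?r"
    unfolding card_of_ordLeq2[symmetric, OF ne] by blast
  define en where "en x = fst (dec x)" for x
  define rank where "rank x = snd (snd (dec x))" for x
  define R where "R = inv_image (?r - Id) rank"
  \<comment> \<open>Only points whose function is injective with values of smaller rank are
    kept.\<close>
  define Dom where "Dom = {x \<in> ?X. inj_on (en x) L \<and> (\<forall>a\<in>L. (en x a, x) \<in> R)}"
  have dec_mem: "dec x \<in> ?F \<times> ?X \<times> Field ?r" if "x \<in> ?X" for x
    unfolding dec[symmetric] using that by (rule imageI)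
  have en_F: "en x \<in> ?F" and rank_F: "rank x \<in> Field ?r" if "x \<in> ?X" for x
    using dec_mem[OF that] by (auto simp: en_def rank_def mem_Times_iff)
  show thesis
  proof (rule that[of R Dom en]; (intro ballI allI impI)?)
    show "wf R" unfolding R_def using wr by (simp add: well_order_on_def)
    show "Dom \<subseteq> Pow K" by (auto simp: Dom_def)
    show "inj_on (en x) L" if "x \<in> Dom" for x using that by (simp add: Dom_def)
    show "en x ` L \<subseteq> Pow K" if "x \<in> Dom" for x
    proof -
      have "x \<in> ?X" using that by (simp add: Dom_def)
      from en_F[OF this] show ?thesis by (auto simp: Func_def)
    qed
    show "(en x a, x) \<in> R" if "x \<in> Dom" "a \<in> L" for x a using that by (simp add: Dom_def)
  next
    fix A assume A: "A \<subseteq> Pow K" "|L| \<le>o |A|"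
    obtain f where f: "inj_on f L" "f ` L \<subseteq> A" using A(2) unfolding card_of_ordLeq[symmetric] by blast
    define f' where "f' l = (if l \<in> L then f l else undefined)" for l
    have fX: "f l \<in> ?X" if "l \<in> L" for l using f(2) A(1) that by blast
    have f'_inj: "inj_on f' L" using f(1) by (simp add: f'_def inj_on_def)
    have f'_A: "f' ` L \<subseteq> A" using f(2) by (auto simp: f'_def)
    have f'_F: "f' \<in> ?F" using fX by (simp add: f'_def Func_def)
    have "rank (f' l) \<in> Field ?r" if "l \<in> L" for l
      using that f'_A A(1) by (intro rank_F) blast
    then have "(\<lambda>l. rank (f' l)) ` L \<subseteq> Field ?r" by (rule image_subsetI)
    moreover have "|(\<lambda>l. rank (f' l)) ` L| \<le>o |L|" by (rule card_of_image)
    \<comment> \<open>By regularity some rank lies above those of all values of \<open>f'\<close>.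
      With this rank every label \<open>w\<close> yields a point of \<open>Dom\<close>.\<close>
    ultimately obtain s where s: "s \<in> Field ?r" "(\<lambda>l. rank (f' l)) ` L \<subseteq> underS ?r s"
      by (rule cardSuc_bounded[OF L])
    have "?X \<subseteq> (\<lambda>x. fst (snd (dec x))) ` {x \<in> Dom. en x ` L \<subseteq> A}"
    proof
      fix w assume w: "w \<in> ?X"
      have "(f', w, s) \<in> dec ` ?X" unfolding dec using f'_F w s(1) by blast
      then obtain x where x: "x \<in> ?X" "dec x = (f', w, s)" by (auto simp: image_iff)
      have "(rank (f' a), s) \<in> ?r - Id" if "a \<in> L" for a
        using s(2) that by (auto simp: underS_def)
      then have "x \<in> Dom" using x f'_inj by (simp add: Dom_def R_def en_def rank_def)
      then show "w \<in> (\<lambda>x. fst (snd (dec x))) ` {x \<in> Dom. en x ` L \<subseteq> A}"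
        using x f'_A by (intro rev_image_eqI[of x]) (auto simp: en_def)
    qed
    then show "|Pow K| \<le>o |{x \<in> Dom. en x ` L \<subseteq> A}|"
      by (rule subset_ordLeq) (rule card_of_image)
  qed
qed

section \<open>The topology of a family of ultrafilters\<close>

text \<open>Joining \<open>z\<close> to the members of \<open>E z\<close> gives an acyclic graph on
  \<open>C\<close> in which no point has two parents. The descendants of one of \<open>x\<close>,
  \<open>y\<close> omit the other, and this set is extended off \<open>C\<close> by recursion along
  \<open>R\<close>.\<close>

lemma clopen_separation:
  fixes D :: "'x \<Rightarrow> 'x set set"
  assumes wf: "wf R"
    and ultra: "\<And>z. z \<in> Dom \<Longrightarrow> ultra (D z)"
    and free: "\<And>z w. z \<in> Dom \<Longrightarrow> {w} \<notin> D z"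
    and A: "\<And>z. z \<in> Dom \<Longrightarrow> A z \<in> D z" "\<And>z a. \<lbrakk>z \<in> Dom; a \<in> A z\<rbrakk> \<Longrightarrow> (a, z) \<in> R"
    and E: "\<And>z. z \<in> C \<inter> Dom \<Longrightarrow> E z \<in> D z" "\<And>z. z \<in> C \<inter> Dom \<Longrightarrow> E z \<subseteq> C \<inter> A z"
    and disj: "\<And>z z'. \<lbrakk>z \<in> C \<inter> Dom; z' \<in> C \<inter> Dom; E z \<inter> E z' \<noteq> {}\<rbrakk> \<Longrightarrow> z = z'"
    and xy: "x \<in> C" "y \<in> C" "x \<noteq> y"
  shows "\<exists>U. (\<forall>z\<in>Dom. z \<in> U \<longleftrightarrow> U \<in> D z) \<and> (x \<in> U) \<noteq> (y \<in> U)"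
proof -
  define ch where "ch = {(z, a). z \<in> C \<inter> Dom \<and> a \<in> E z}"
  have "ch\<inverse> \<subseteq> R" using E(2) A(2) by (fastforce simp: ch_def)
  then have "acyclic (ch\<inverse>)" using wf by (meson wf_acyclic wf_subset)
  then have acyc: "acyclic ch" by (simp add: acyclic_converse)
  have *: "\<exists>U. (\<forall>z\<in>Dom. z \<in> U \<longleftrightarrow> U \<in> D z) \<and> x \<in> U \<and> y \<notin> U"
    if x: "x \<in> C" and y: "y \<in> C" and xy: "(x, y) \<notin> ch\<^sup>*" for x y
  proof -
    define V where "V = {w. (x, w) \<in> ch\<^sup>*}"
    have VC: "V \<subseteq> C"
    proof
      fix w assume "w \<in> V"
      then have "(x, w) \<in> ch\<^sup>*" by (simp add: V_def)
      then show "w \<in> C"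
        using x E(2) by (induction rule: rtrancl_induct) (auto simp: ch_def)
    qed
    \<comment> \<open>Off \<open>C\<close>, the part of \<open>U\<close> below \<open>z\<close>
      decides whether \<open>z\<close> joins. This agrees with \<open>U \<in> D z\<close> because
      \<open>A z\<close> lies below \<open>z\<close> and belongs to \<open>D z\<close>.\<close>
    define H where "H f z \<longleftrightarrow> (if z \<in> C then z \<in> V else z \<in> Dom \<and> {w. (w, z) \<in> R \<and> f w} \<in> D z)" for f z
    define U where "U = {z. wfrec R H z}"
    have U: "z \<in> U \<longleftrightarrow> (if z \<in> C then z \<in> V else z \<in> Dom \<and> {w. (w, z) \<in> R \<and> w \<in> U} \<in> D z)" for z
    proof -
      have "{w. (w, z) \<in> R \<and> cut (wfrec R H) R z w} = {w. (w, z) \<in> R \<and> wfrec R H w}"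
        by (auto simp: cut_apply)
      then show ?thesis
        unfolding U_def mem_Collect_eq by (subst wfrec[OF wf]) (simp add: H_def)
    qed
    have UC: "U \<inter> C = V"
    proof (rule set_eqI)
      show "z \<in> U \<inter> C \<longleftrightarrow> z \<in> V" for z using U[of z] VC by auto
    qed
    have "z \<in> U \<longleftrightarrow> U \<in> D z" if z: "z \<in> Dom" for z
    proof (cases "z \<in> C")
      case True
      then have zC: "z \<in> C \<inter> Dom" using z by blast
      show ?thesis
      proof (cases "z \<in> V")
        case True
        have "E z \<subseteq> V"
        proof
          fix a assume "a \<in> E z"
          then have "(z, a) \<in> ch" using zC by (simp add: ch_def)
          then show "a \<in> V" using True unfolding V_def by (simp add: rtrancl_into_rtrancl)
        qed
        then have "E z \<subseteq> U" using UC by blast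
        then have "U \<in> D z" by (rule ultra_mono[OF ultra[OF z] E(1)[OF zC]])
        then show ?thesis using True UC by blast
      next
        case False
        \<comment> \<open>A descendant of \<open>x\<close> other than \<open>x\<close> has a parent
          in \<open>V\<close>, and the only parent of a point of \<open>E z\<close> is
          \<open>z\<close>. The possible exception \<open>x\<close> is harmless since
          \<open>D z\<close> contains no singleton.\<close>
        have "E z \<inter> U \<subseteq> {x}"
        proof
          fix a assume a: "a \<in> E z \<inter> U"
          then have "a \<in> V" using E(2)[OF zC] UC by blast
          then have "(x, a) \<in> ch\<^sup>*" by (simp add: V_def)
          then show "a \<in> {x}"
          proof (cases rule: rtranclE)
            case (step w)
            then have "w \<in> C \<inter> Dom" "a \<in> E w" by (simp_all add: ch_def)
            then have "w = z" using disj[OF _ zC] a by blast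
            then have "z \<in> V" using step(1) by (simp add: V_def)
            then show ?thesis using False by blast
          qed simp
        qed
        then have "E z \<inter> U \<notin> D z"
          using ultra_mono[OF ultra[OF z]] free[OF z] by blast
        then have "U \<notin> D z" using ultra_Int_iff[OF ultra[OF z]] E(1)[OF zC] by blast
        moreover have "z \<notin> U" using False True UC by blast
        ultimately show ?thesis by blast
      qed
    next
      case False
      have "z \<in> U \<longleftrightarrow> {w. (w, z) \<in> R \<and> w \<in> U} \<in> D z" using U[of z] False z by simp
      also have "\<dots> \<longleftrightarrow> U \<in> D z"
      proof
        assume "{w. (w, z) \<in> R \<and> w \<in> U} \<in> D z"
        then show "U \<in> D z" by (rule ultra_mono[OF ultra[OF z]]) blast
      next
        assume "U \<in> D z"
        then have "A z \<inter> U \<in> D z" using ultra_Int_iff[OF ultra[OF z]] A(1)[OF z] by blast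
        then show "{w. (w, z) \<in> R \<and> w \<in> U} \<in> D z"
          by (rule ultra_mono[OF ultra[OF z]]) (use A(2)[OF z] in blast)
      qed
      finally show ?thesis .
    qed
    moreover have "x \<in> U" using UC x by (auto simp: V_def)
    moreover have "y \<notin> U" using UC y xy by (auto simp: V_def)
    ultimately show ?thesis by blast
  qed
  have "(x, y) \<notin> ch\<^sup>* \<or> (y, x) \<notin> ch\<^sup>*"
    using acyc xy(3) by (meson acyclic_impl_antisym_rtrancl antisymD)
  then show ?thesis using *[OF xy(1,2)] *[OF xy(2,1)] by blast
qed

text \<open>The sets \<open>U\<close> with \<open>z \<in> U\<close> equivalent to
  \<open>U \<in> D z\<close> form a Boolean algebra because each \<open>D z\<close> is an
  ultrafilter, so as a base they are clopen. A basic neighbourhood of \<open>z\<close> belongs to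
  \<open>D z\<close> and hence meets every member of \<open>D z\<close>.\<close>

lemma ultrafilter_topology:
  fixes D :: "'x \<Rightarrow> 'x set set"
  assumes Dom: "Dom \<subseteq> X"
    and ultra: "\<And>z. z \<in> Dom \<Longrightarrow> ultra (D z)" "\<And>z. z \<in> Dom \<Longrightarrow> X \<in> D z"
    and sep: "\<And>x y. \<lbrakk>x \<in> X; y \<in> X; x \<noteq> y\<rbrakk> \<Longrightarrow>
      \<exists>U. (\<forall>z\<in>Dom. z \<in> U \<longleftrightarrow> U \<in> D z) \<and> (x \<in> U) \<noteq> (y \<in> U)"
  obtains T where "topspace T = X" "Hausdorff_space T" "has_clopen_basis T"
    "\<And>Y z. \<lbrakk>closedin T Y; z \<in> Dom; Y \<in> D z\<rbrakk> \<Longrightarrow> z \<in> Y"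
proof -
  define \<B> where "\<B> = {U. U \<subseteq> X \<and> (\<forall>z\<in>Dom. z \<in> U \<longleftrightarrow> U \<in> D z)}"
  have B_Int: "U \<inter> V \<in> \<B>" if "U \<in> \<B>" "V \<in> \<B>" for U V
    using that ultra_Int_iff[OF ultra(1)] unfolding \<B>_def by blast
  have B_X: "X \<in> \<B>" using Dom ultra(2) by (auto simp: \<B>_def)
  have B_Compl: "X - U \<in> \<B>" if "U \<in> \<B>" for U
  proof -
    have "X - U \<in> D z \<longleftrightarrow> U \<notin> D z" if "z \<in> Dom" for z
      using ultra_Int_iff[OF ultra(1)[OF that], of X "- U"] ultra(2)[OF that]
        ultra_Compl_iff[OF ultra(1)[OF that]] by (simp add: Diff_eq)
    then show ?thesis using that Dom unfolding \<B>_def by blast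
  qed
  define T where "T = topology (arbitrary union_of (\<lambda>U. U \<in> \<B>))"
  have "istopology (arbitrary union_of (\<lambda>U. U \<in> \<B>))"
    by (rule istopology_base) (rule B_Int)
  then have openT: "openin T = arbitrary union_of (\<lambda>U. U \<in> \<B>)"
    by (simp add: T_def)
  have openB: "openin T U" if "U \<in> \<B>" for U
    unfolding openT using that by (rule arbitrary_union_of_inc)
  have top: "topspace T = X"
  proof
    show "X \<subseteq> topspace T" using openin_subset[OF openB[OF B_X]] .
    have "openin T (topspace T)" by simp
    then show "topspace T \<subseteq> X"
      unfolding openT union_of_def by (auto simp: \<B>_def)
  qed
  have closedB: "closedin T U" if "U \<in> \<B>" for U
    using that openB[OF B_Compl[OF that]] unfolding closedin_def top by (auto simp: \<B>_def)
  show thesis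
  proof (rule that[of T])
    show "topspace T = X" by (rule top)
    show "has_clopen_basis T"
      unfolding has_clopen_basis_def using openT openB closedB by blast
    show "Hausdorff_space T" unfolding Hausdorff_space_def top
    proof (intro allI impI)
      fix x y assume xy: "x \<in> X \<and> y \<in> X \<and> x \<noteq> y"
      then obtain U where U: "\<forall>z\<in>Dom. z \<in> U \<longleftrightarrow> U \<in> D z" "(x \<in> U) \<noteq> (y \<in> U)"
        using sep by blast
      have "X \<inter> U \<in> \<B>" using U(1) Dom ultra ultra_Int_iff[OF ultra(1)] unfolding \<B>_def by blast
      then have "openin T (X \<inter> U)" "openin T (X - X \<inter> U)" using openB B_Compl by blast+
      moreover have "disjnt (X \<inter> U) (X - X \<inter> U)" "disjnt (X - X \<inter> U) (X \<inter> U)"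
        by (auto simp: disjnt_def)
      ultimately show "\<exists>U V. openin T U \<and> openin T V \<and> x \<in> U \<and> y \<in> V \<and> disjnt U V"
        using U(2) xy by blast
    qed
    fix Y z assume Y: "closedin T Y" and z: "z \<in> Dom" and YD: "Y \<in> D z"
    show "z \<in> Y"
    proof (rule ccontr)
      assume "z \<notin> Y"
      then have "z \<in> X - Y" using z Dom by blast
      moreover have "openin T (X - Y)" using Y top by (simp add: closedin_def)
      ultimately obtain U where U: "U \<in> \<B>" "z \<in> U" "U \<subseteq> X - Y"
        unfolding openT union_of_def by blast
      then have "U \<in> D z" using z by (simp add: \<B>_def)
      moreover have "U \<inter> Y = {}" using U(3) by blast
      ultimately show False using ultra_disjoint[OF ultra(1)[OF z]] YD by blast
    qed
  qed
qed

section \<open>The space\<close>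

lemma closure_ordLeq:
  assumes L: "infinite L" and W: "|W| \<le>o |L|" and A: "\<And>z. z \<in> M \<Longrightarrow> |A z| \<le>o |L|"
  obtains C where "W \<subseteq> C" "|C| \<le>o |L|" "\<forall>z\<in>C \<inter> M. A z \<subseteq> C"
    "C \<subseteq> W \<union> (\<Union>z\<in>M. A z)"
proof -
  define V where "V = rec_nat W (\<lambda>_ V. \<Union>z\<in>V \<inter> M. A z)"
  have V: "|V n| \<le>o |L|" for n
  proof (induction n)
    case (Suc n)
    have "|V n \<inter> M| \<le>o |L|" by (rule subset_ordLeq[OF _ Suc]) blast
    then have "|\<Union>z\<in>V n \<inter> M. A z| \<le>o |L|"
      by (intro card_of_UNION_ordLeq_infinite L) (use A in auto)
    then show ?case by (simp add: V_def)
  qed (simp add: V_def W)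
  have "V n \<subseteq> W \<union> (\<Union>z\<in>M. A z)" for n
    by (cases n) (auto simp: V_def)
  show thesis
  proof (rule that[of "\<Union>n. V n"]; (intro ballI)?)
    have "V 0 = W" by (simp add: V_def)
    then show "W \<subseteq> (\<Union>n. V n)" by blast
    show "|\<Union>n. V n| \<le>o |L|"
      using L V infinite_iff_card_of_nat[of L] by (intro card_of_UNION_ordLeq_infinite) auto
    show "A z \<subseteq> (\<Union>n. V n)" if z: "z \<in> (\<Union>n. V n) \<inter> M" for z
    proof -
      obtain n where "z \<in> V n" using z by blast
      then have "A z \<subseteq> V (Suc n)" using z by (auto simp: V_def)
      then show ?thesis by blast
    qed
    show "(\<Union>n. V n) \<subseteq> W \<union> (\<Union>z\<in>M. A z)"
      using \<open>\<And>n. V n \<subseteq> W \<union> (\<Union>z\<in>M. A z)\<close> by blast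
  qed
qed

text \<open>The range of \<open>en x\<close> belongs to \<open>D x\<close>, so a closed set
  containing this range contains \<open>x\<close>. A closed set of size at least
  \<open>|Field r|\<close> contains the ranges for \<open>|Pow K|\<close> many
  \<open>x\<close>.\<close>

lemma limit_cardinal_space:
  fixes r :: "'a rel" and K :: "'k set"
  assumes wr: "Well_order r" and lim: "uncountable_limit r" and inf: "infinite (Field r)"
    and LK: "|Field r| \<le>o |K|" and KL: "|K| \<le>o |Pow (Field r)|"
  obtains T :: "'k set topology" where "topspace T = Pow K" "Hausdorff_space T" "has_clopen_basis T"
    "\<forall>Y. closedin T Y \<longrightarrow> |Field r| \<le>o |Y| \<longrightarrow> |Pow K| \<le>o |Y|"
proof -
  let ?L = "Field r"
  have ne: "?L \<noteq> {}" using inf by auto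
  obtain \<I> :: "'a set set" and Hit :: "'a set \<Rightarrow> 'a \<Rightarrow> 'a set" where
    \<I>: "{} \<in> \<I> \<and> (\<forall>a. {a} \<in> \<I>) \<and> (\<forall>M\<in>\<I>. \<forall>N\<in>\<I>. M \<union> N \<in> \<I>) \<and> (\<forall>t v. Hit t v \<subseteq> ?L) \<and>
    (\<forall>T v N. finite T \<longrightarrow> T \<subseteq> Pow ?L \<longrightarrow> v ` T \<subseteq> ?L \<longrightarrow> N \<in> \<I> \<longrightarrow>
      (\<exists>a. a \<notin> N \<and> (\<forall>t\<in>T. a \<in> Hit t (v t)))) \<and>
    (\<forall>(C :: 'k set set) g (e :: 'k set \<Rightarrow> 'a \<Rightarrow> 'k set). inj_on g C \<longrightarrow> (\<forall>x\<in>C. inj_on (e x) ?L) \<longrightarrow>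
      (\<exists>N\<in>\<I>. \<forall>x\<in>C. \<forall>y\<in>C. \<forall>t. \<forall>a\<in>Hit t (g x) - N. \<forall>b\<in>Hit t (g y) - N.
        e x a = e y b \<longrightarrow> x = y))"
    using limit_colouring[OF wr lim ne, where ?'x = "'k set" and ?'y = "'k set"] by (elim exE)
  then have I_empty: "{} \<in> \<I>" and I_sing: "\<And>a. {a} \<in> \<I>"
    and I_Un: "\<And>M N. \<lbrakk>M \<in> \<I>; N \<in> \<I>\<rbrakk> \<Longrightarrow> M \<union> N \<in> \<I>" and Hit_Field: "\<And>t v. Hit t v \<subseteq> ?L"
    by simp_all
  note Hit_independent = \<I>[THEN conjunct2, THEN conjunct2, THEN conjunct2, THEN conjunct2,
      THEN conjunct1, rule_format]
    and Hit_disjoint = \<I>[THEN conjunct2, THEN conjunct2, THEN conjunct2, THEN conjunct2,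
      THEN conjunct2]
  obtain g :: "'a set \<Rightarrow> 'k set \<Rightarrow> 'a" where g_L: "\<forall>t x. g t x \<in> ?L"
    and g_inj: "\<forall>C\<subseteq>Pow K. |C| \<le>o |?L| \<longrightarrow> (\<exists>t\<subseteq>?L. inj_on (g t) C)"
    by (rule separating_codes[OF inf KL])
  obtain en :: "'k set \<Rightarrow> 'a \<Rightarrow> 'k set" and Dom R where wf: "wf R" and Dom: "Dom \<subseteq> Pow K"
    and en: "\<forall>x\<in>Dom. inj_on (en x) ?L" "\<forall>x\<in>Dom. en x ` ?L \<subseteq> Pow K"
      "\<forall>x\<in>Dom. \<forall>a\<in>?L. (en x a, x) \<in> R"
    and en_all: "\<forall>A\<subseteq>Pow K. |?L| \<le>o |A| \<longrightarrow> |Pow K| \<le>o |{x \<in> Dom. en x ` ?L \<subseteq> A}|"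
    by (rule well_founded_enumeration[OF inf LK])
  have en_inj: "inj_on (en x) ?L" and en_K: "en x ` ?L \<subseteq> Pow K"
    and en_R: "\<And>a. a \<in> ?L \<Longrightarrow> (en x a, x) \<in> R" if "x \<in> Dom" for x
    using en that by blast+
  \<comment> \<open>All \<open>t\<close> have to be included here, since the one that gives distinct
    codes depends on the pair of points to be separated.\<close>
  define Q where "Q x = (\<lambda>(t, N). en x ` (Hit t (g t x) - N)) ` (Pow ?L \<times> \<I>)" for x
  have Q_I: "en x ` (Hit t (g t x) - N) \<in> Q x" if "t \<subseteq> ?L" "N \<in> \<I>" for x t N
    unfolding Q_def using that by force
  have "\<exists>D. ultra D \<and> Q x \<subseteq> D" for x
  proof -
    have "\<Inter>F \<noteq> {}" if F: "finite F" "F \<subseteq> Q x" for F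
    proof -
      obtain G where G: "finite G" "G \<subseteq> Pow ?L \<times> \<I>" "F = (\<lambda>(t, N). en x ` (Hit t (g t x) - N)) ` G"
        using finite_subset_image[OF F[unfolded Q_def]] by blast
      have "\<Union>(snd ` G) \<in> \<I>"
        using G(1,2) by (induction G) (auto intro: I_empty I_Un)
      moreover have "finite (fst ` G)" using G(1) by simp
      moreover have "fst ` G \<subseteq> Pow ?L" using G(2) by (auto dest!: subsetD)
      moreover have "(\<lambda>t. g t x) ` fst ` G \<subseteq> ?L" using g_L by auto
      ultimately obtain a where a: "a \<notin> \<Union>(snd ` G)" "\<forall>t\<in>fst ` G. a \<in> Hit t (g t x)"
        using Hit_independent[of "fst ` G" "\<lambda>t. g t x" "\<Union>(snd ` G)"] by auto
      have "en x a \<in> \<Inter>F" unfolding G(3) using a by force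
      then show ?thesis by blast
    qed
    then show ?thesis by (rule ultra_exists) blast+
  qed
  then have "\<forall>x. \<exists>D. ultra D \<and> Q x \<subseteq> D" by blast
  from choice[OF this] obtain D where D: "\<And>x. ultra (D x)" "\<And>x. Q x \<subseteq> D x" by blast
  have D_I: "en x ` (Hit t (g t x) - N) \<in> D x" if "t \<subseteq> ?L" "N \<in> \<I>" for x t N
    using Q_I[OF that] D(2) by blast
  have D_en: "en x ` ?L \<in> D x" for x
  proof (rule ultra_mono[OF D(1) D_I])
    show "en x ` (Hit {} (g {} x) - {}) \<subseteq> en x ` ?L" using Hit_Field by blast
  qed (use I_empty in auto)
  \<comment> \<open>At most one index is mapped to \<open>w\<close>, and singletons belong to
    \<open>\<I>\<close>.\<close>
  have D_free: "{w} \<notin> D x" if x: "x \<in> Dom" for x w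
  proof -
    define N where "N = {a \<in> ?L. en x a = w}"
    have "N \<in> \<I>"
    proof (cases "N = {}")
      case False
      then obtain a where "a \<in> N" by blast
      then have "N = {a}" using en_inj[OF x] by (auto simp: N_def inj_on_def)
      then show ?thesis using I_sing by simp
    qed (simp add: I_empty)
    then have "en x ` (Hit {} (g {} x) - N) \<in> D x" by (intro D_I) auto
    moreover have "en x ` (Hit {} (g {} x) - N) \<inter> {w} = {}" using Hit_Field by (auto simp: N_def)
    ultimately show ?thesis using ultra_disjoint[OF D(1)] by blast
  qed
  have sep: "\<exists>U. (\<forall>z\<in>Dom. z \<in> U \<longleftrightarrow> U \<in> D z) \<and> (x \<in> U) \<noteq> (y \<in> U)"
    if xy: "x \<in> Pow K" "y \<in> Pow K" "x \<noteq> y" for x y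
  proof -
    have "|{x, y}| \<le>o |?L|" by (intro finite_ordLeq_infinite inf) simp
    moreover have "|en z ` ?L| \<le>o |?L|" for z by (rule card_of_image)
    \<comment> \<open>Closing \<open>{x, y}\<close> under ranges keeps the size at most
      \<open>|Field r|\<close>, so one \<open>t\<close> gives distinct codes on \<open>C\<close> and
      one \<open>N\<close> makes the chosen ultrafilter members disjoint.\<close>
    ultimately obtain C where C: "{x, y} \<subseteq> C" "|C| \<le>o |?L|"
      "\<forall>z\<in>C \<inter> Dom. en z ` ?L \<subseteq> C" "C \<subseteq> {x, y} \<union> (\<Union>z\<in>Dom. en z ` ?L)"
      by (rule closure_ordLeq[OF inf])
    have "C \<subseteq> Pow K" using C(4) en_K xy by blast
    from g_inj[rule_format, OF this C(2)] obtain t where t: "t \<subseteq> ?L" "inj_on (g t) C" by blast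
    have "inj_on (g t) (C \<inter> Dom)" using t(2) by (rule inj_on_subset) blast
    moreover have "\<forall>x\<in>C \<inter> Dom. inj_on (en x) ?L" using en_inj by blast
    ultimately obtain N where N: "N \<in> \<I>" "\<forall>x\<in>C \<inter> Dom. \<forall>y\<in>C \<inter> Dom. \<forall>s. \<forall>a\<in>Hit s (g t x) - N.
        \<forall>b\<in>Hit s (g t y) - N. en x a = en y b \<longrightarrow> x = y"
      using Hit_disjoint[THEN spec[of _ "C \<inter> Dom"], THEN spec[of _ "g t"], THEN spec[of _ en]] by blast
    show ?thesis
    proof (rule clopen_separation[OF wf D(1) D_free D_en])
      show "(a, z) \<in> R" if "z \<in> Dom" "a \<in> en z ` ?L" for z a using that en_R by blast
      show "en z ` (Hit t (g t z) - N) \<in> D z" for z by (rule D_I[OF t(1) N(1)])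
      show "en z ` (Hit t (g t z) - N) \<subseteq> C \<inter> en z ` ?L" if "z \<in> C \<inter> Dom" for z
        using C(3)[rule_format, OF that] Hit_Field[of t "g t z"] by blast
      show "z = z'" if "z \<in> C \<inter> Dom" "z' \<in> C \<inter> Dom"
        "en z ` (Hit t (g t z) - N) \<inter> en z' ` (Hit t (g t z') - N) \<noteq> {}" for z z'
        using N(2) that by blast
    qed (use C(1) xy(3) in auto)
  qed
  have "Pow K \<in> D z" if "z \<in> Dom" for z
    using ultra_mono[OF D(1) D_en en_K[OF that]] .
  then obtain T where T: "topspace T = Pow K" "Hausdorff_space T" "has_clopen_basis T"
    "\<And>Y z. \<lbrakk>closedin T Y; z \<in> Dom; Y \<in> D z\<rbrakk> \<Longrightarrow> z \<in> Y"
    using ultrafilter_topology[OF Dom D(1) _ sep] by blast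
  show thesis
  proof (rule that[of T]; (intro allI impI)?)
    fix Y assume Y: "closedin T Y" "|?L| \<le>o |Y|"
    have "Y \<subseteq> Pow K" using closedin_subset[OF Y(1)] T(1) by simp
    then have "|Pow K| \<le>o |{x \<in> Dom. en x ` ?L \<subseteq> Y}|" using Y(2) by (rule en_all[rule_format])
    moreover have "{x \<in> Dom. en x ` ?L \<subseteq> Y} \<subseteq> Y"
      using T(4)[OF Y(1)] ultra_mono[OF D(1) D_en] by blast
    ultimately show "|Pow K| \<le>o |Y|"
      using card_of_mono1 ordLeq_transitive by blast
  qed (use T in auto)
qed

section \<open>Application to a singular cardinal\<close>

lemma ctwo_cexp_Pow: "ctwo ^c r =o |Pow (Field r)|"
  unfolding cexp_def ctwo_def Field_card_of by (rule ordIso_symmetric[OF card_of_Pow_Func])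

theorem theorem2p1:
  fixes lam :: "'a rel" and mu :: "'m rel" and kap :: "'k rel"
  assumes "singular_card lam"
    and "mu =o ctwo ^c lam"
    and "is_min_card {k :: 'k rel. Card_order k \<and> mu <o ctwo ^c k} kap"
  shows "\<exists>X :: 'k set topology.
           Hausdorff_space X \<and>
           has_clopen_basis X \<and>
           |topspace X| =o ctwo ^c kap \<and>
           (\<forall>Y. closedin X Y \<and> |Y| <o |topspace X| \<longrightarrow> |Y| <o lam)"
proof -
  have lam: "Card_order lam" and inf: "infinite (Field lam)"
    using assms(1) by (auto simp: singular_card_def cinfinite_def)
  have wr: "Well_order lam" using lam by (rule card_order_on_well_order_on)
  have kap: "Card_order kap" and mu_kap: "mu <o ctwo ^c kap"
    using assms(3) by (auto simp: is_min_card_def)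
  have mu: "Card_order mu" using Card_order_cexp assms(2) by (rule Card_order_ordIso)
  have lamL: "lam =o |Field lam|" and kapK: "kap =o |Field kap|"
    using card_of_Field_ordIso[OF lam] card_of_Field_ordIso[OF kap] ordIso_symmetric by blast+
  \<comment> \<open>Otherwise \<open>2^kap\<close> would be at most \<open>2^lam\<close>, which is
    \<open>mu\<close>.\<close>
  have "\<not> kap \<le>o lam"
  proof
    assume "kap \<le>o lam"
    then have "|Field kap| \<le>o |Field lam|" by (rule card_of_mono2)
    then have "|Pow (Field kap)| \<le>o |Pow (Field lam)|" by (rule Pow_ordLeq_Pow)
    with ctwo_cexp_Pow have "ctwo ^c kap \<le>o |Pow (Field lam)|" by (rule ordIso_ordLeq_trans)
    also have "|Pow (Field lam)| =o ctwo ^c lam" using ctwo_cexp_Pow by (rule ordIso_symmetric)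
    also have "ctwo ^c lam =o mu" using assms(2) by (rule ordIso_symmetric)
    finally show False using mu_kap not_ordLess_ordLeq by blast
  qed
  then have "lam \<le>o kap"
    using ordLeq_total[OF wr card_order_on_well_order_on[OF kap]] by blast
  then have LK: "|Field lam| \<le>o |Field kap|" by (rule card_of_mono2)
  \<comment> \<open>As \<open>mu\<close> is less than \<open>2^mu\<close>, it competes with
    \<open>kap\<close> as an exponent; \<open>least_exponent_global\<close> compares them across
    types.\<close>
  have "kap \<le>o mu"
    using assms(3) mu ordLess_ctwo_cexp[OF mu] by (rule least_exponent_global)
  also have "mu =o |Pow (Field lam)|"
    using assms(2) ctwo_cexp_Pow by (rule ordIso_transitive)
  finally have KL: "|Field kap| \<le>o |Pow (Field lam)|"
    using card_of_mono2 Field_card_of by metis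
  obtain X :: "'k set topology" where X: "topspace X = Pow (Field kap)" "Hausdorff_space X"
    "has_clopen_basis X"
    "\<forall>Y. closedin X Y \<longrightarrow> |Field lam| \<le>o |Y| \<longrightarrow> |Pow (Field kap)| \<le>o |Y|"
    by (rule limit_cardinal_space[OF wr singular_uncountable_limit[OF assms(1)] inf LK KL])
  have "|Y| <o lam" if Y: "closedin X Y" "|Y| <o |topspace X|" for Y
  proof -
    have "\<not> |Field lam| \<le>o |Y|"
      using X(1,4) Y not_ordLess_ordLeq by metis
    then have "|Y| <o |Field lam|"
      using ordLess_or_ordLeq[OF card_of_Well_order card_of_Well_order] by blast
    then show ?thesis using ordLess_ordIso_trans[OF _ ordIso_symmetric[OF lamL]] by blast
  qed
  then show ?thesis
    using X(1,2,3) ordIso_symmetric[OF ctwo_cexp_Pow] by (intro exI[of _ X]) simp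
qed

end
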